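(* Let $V:\mathrm{Lip}(S^1)\longrightarrow\mathbb{R}$ be a $\tau$-continuous and rotation invariant valuation. Then there exists $K:\mathbb{R}\times\mathbb{R}_+\longrightarrow\mathbb{R}$ such that $K(\cdot,\gamma)$ is a Borel function for every $\gamma\in\mathbb{R}_+$ and, for every $f\in\mathcal{L}(S^1)$, $$V(f)=\int_0^{2\pi}K(f(t),|f'(t)|)\,dH^1(t).$$ In particular, for every $f\in\mathrm{Lip}(S^1)$ and every sequence $\{f_i\}\subset\mathcal{L}(S^1)$ such that $f_i\overset{\tau}{\rightarrow}f$, $$V(f)=\lim_{i\to\infty}\int_0^{2\pi}K(f_i(t),|f_i'(t)|)\,dH^1(t).$$
   Context: $\mathbb{R}_+=[0,+\infty)$. $S^1$ is the Euclidean unit circle in $\mathbb{R}^2$ and $\mathrm{Lip}(S^1)$ is the space of Lipschitz continuous functions $f:S^1\to\mathbb{R}$ (with respect to the Euclidean distance). Functions on $S^1$ are identified (via $t\mapsto(\cos t,\sin t)$) with functions $f$ on $[0,2\pi]$ with $f(0)=f(2\pi)$; under this identification the norm of the spherical gradient is $|f'(t)|$, where $f'$ is the usual derivative, which exists a.e. $\mathcal{L}(S^1)\subset\mathrm{Lip}(S^1)$ is the set of (continuous) piecewise linear functions $f$ on $[0,2\pi]$ with $f(0)=f(2\pi)$. $H^1$ is the one-dimensional Hausdorff measure on $S^1$ normalized so that $H^1(S^1)=1$; "a.e." refers to $H^1$. A valuation on $\mathrm{Lip}(S^1)$ is a map $V:\mathrm{Lip}(S^1)\to\mathbb{R}$ with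 $V(f\vee g)+V(f\wedge g)=V(f)+V(g)$ for all $f,g$, where $\vee,\wedge$ are pointwise maximum and minimum. $V$ is rotation invariant if $V(f\circ\varphi)=V(f)$ for every $f$ and every $\varphi$ in the orthogonal group $\mathbf{O}(2)$ acting on $S^1$. For $f,f_k\in\mathrm{Lip}(S^1)$, $f_k\overset{\tau}{\rightarrow}f$ means: (1) $\|f_k-f\|_\infty\to0$; (2) there is $C>0$ with $\sup_k|f_k'(t)|\le C$ for a.e. $t$; (3) $f_k'(t)\to f'(t)$ for a.e. $t$. $V$ is $\tau$-continuous if $V(f_k)\to V(f)$ whenever $f_k\overset{\tau}{\rightarrow}f$. *)

theory Defs
  imports "HOL-Analysis.Analysis"
begin

text \<open>The Euclidean plane is represented by \<^typ>\<open>complex\<close>, so that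
  \<open>cis t = (cos t, sin t)\<close>.\<close>

abbreviation S1 :: "complex set" where
  "S1 \<equiv> sphere 0 1"

text \<open>Functions on the circle are total functions that are \<open>undefined\<close> off the circle, so that
  HOL equality is equality on the circle. Pointwise max and min, as well as composition with an
  orthogonal map of the plane, preserve this property.\<close>

definition Lip_S1 :: "(complex \<Rightarrow> real) set" where
  "Lip_S1 = {f \<in> extensional S1. \<exists>L. L-lipschitz_on S1 f}"

definition PL_S1 :: "(complex \<Rightarrow> real) set" where
  "PL_S1 = {f \<in> Lip_S1. \<exists>(n::nat) (t :: nat \<Rightarrow> real). t 0 = 0 \<and> t n = 2 * pi \<and>
     (\<forall>i<n. t i < t (Suc i) \<and> (\<exists>a b. \<forall>s\<in>{t i..t (Suc i)}. f (cis s) = a * s + b))}"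

text \<open>The derivative \<open>f'(t)\<close>, as a function of the point \<open>x = cis t\<close> with \<open>0 \<le> t < 2\<pi>\<close>. Its value is
  arbitrary at points where \<open>f\<close> is not differentiable.\<close>

definition circle_deriv :: "(complex \<Rightarrow> real) \<Rightarrow> complex \<Rightarrow> real" where
  "circle_deriv f x = deriv (\<lambda>t. f (cis t)) (Arg2pi x)"

text \<open>The boundedness condition is needed because \<^const>\<open>diameter\<close> is real-valued and carries no
  information on unbounded sets.\<close>

definition hausdorff1_delta :: "real \<Rightarrow> 'a::metric_space set \<Rightarrow> ennreal" where
  "hausdorff1_delta \<delta> A =
     (INF U \<in> {U :: nat \<Rightarrow> 'a set. A \<subseteq> (\<Union>i. U i) \<and> (\<forall>i. bounded (U i) \<and> diameter (U i) \<le> \<delta>)}.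
        \<Sum>i. ennreal (diameter (U i)))"

definition hausdorff1 :: "'a::metric_space set \<Rightarrow> ennreal" where
  "hausdorff1 A = (SUP \<delta>\<in>{0<..}. hausdorff1_delta \<delta> A)"

definition H1 :: "complex measure" where
  "H1 = measure_of S1 (sets (restrict_space borel S1)) (\<lambda>A. hausdorff1 A / hausdorff1 S1)"

definition valuation_on_Lip :: "((complex \<Rightarrow> real) \<Rightarrow> real) \<Rightarrow> bool" where
  "valuation_on_Lip V \<longleftrightarrow> (\<forall>f\<in>Lip_S1. \<forall>g\<in>Lip_S1.
     V (\<lambda>x. max (f x) (g x)) + V (\<lambda>x. min (f x) (g x)) = V f + V g)"

definition rotation_invariant :: "((complex \<Rightarrow> real) \<Rightarrow> real) \<Rightarrow> bool" where
  "rotation_invariant V \<longleftrightarrow>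
     (\<forall>f\<in>Lip_S1. \<forall>\<phi>. orthogonal_transformation \<phi> \<longrightarrow> V (f \<circ> \<phi>) = V f)"

definition tau_converges :: "(nat \<Rightarrow> complex \<Rightarrow> real) \<Rightarrow> (complex \<Rightarrow> real) \<Rightarrow> bool" where
  "tau_converges F f \<longleftrightarrow>
     uniform_limit S1 F f sequentially \<and>
     (\<exists>C>0. AE x in H1. \<forall>k. \<bar>circle_deriv (F k) x\<bar> \<le> C) \<and>
     (AE x in H1. (\<lambda>k. circle_deriv (F k) x) \<longlonglongrightarrow> circle_deriv f x)"

definition tau_continuous :: "((complex \<Rightarrow> real) \<Rightarrow> real) \<Rightarrow> bool" where
  "tau_continuous V \<longleftrightarrow> (\<forall>F. \<forall>f\<in>Lip_S1.
     (\<forall>k. F k \<in> Lip_S1) \<and> tau_converges F f \<longrightarrow> (\<lambda>k. V (F k)) \<longlonglongrightarrow> V f)"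

end

theory Submission
  imports Defs
begin

text \<open>The value of a valuation on a piecewise linear function is the sum of contributions of its linear
pieces. The proof makes this precise, computes the contributions, and writes each of them as an
integral along the piece.

\<^bold>\<open>Cutting a function into arcs.\<close> Work with \<open>2\<pi>\<close>-periodic functions on the line. Fix a floor \<open>c\<close> and a
steep slope \<open>l\<close>, and for a set \<open>E\<close> let \<open>cones c l E f\<close> be the function that agrees with \<open>f\<close> on \<open>E\<close>,
falls off with slope \<open>l\<close> outside \<open>E\<close> and is cut off from below at \<open>c\<close>. Over the union of two arcs
with a common endpoint it is the maximum of the functions of the two arcs, and the minimum of these
two functions is the narrow spike over the common endpoint (\<open>cones_Un\<close>, \<open>cones_Int\<close>). So the valuation
property says that the quantity \<open>ramp c l f a b\<close>, the value on the function of the arc with half the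
value of the spike subtracted for each endpoint, is additive in the arc (\<open>ramp_add\<close>), and two
complementary arcs together recover \<open>V f\<close> (\<open>ramp_close\<close>).

\<^bold>\<open>Contributions of linear pieces.\<close> On a constant piece the contribution is additive and continuous
in the length, hence linear in it, and the constant functions give the factor (\<open>ramp_const\<close>). A piece
that ascends with slope \<open>\<gamma> > 0\<close> from \<open>u\<close> to \<open>v\<close> contributes, by reflection, as much as one that
descends from \<open>v\<close> to \<open>u\<close> with slope \<open>-\<gamma>\<close>. The
function \<open>spike u \<gamma> v\<close> consists of two such pieces and a constant one, so the contribution can be
solved for; up to the share of the floor it is a number \<open>climb \<gamma> u v\<close> in which \<open>c\<close> and \<open>l\<close> no
longer occur (\<open>ramp_descending\<close>, \<open>ramp_ascending\<close>). It is additive in the interval from \<open>u\<close> to \<open>v\<close>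
(\<open>climb_add\<close>).

\<^bold>\<open>The kernel.\<close> For fixed \<open>\<gamma>\<close>, \<open>climb \<gamma> u v\<close> is Lipschitz in \<open>u\<close> and \<open>v\<close> locally. Otherwise there
would be short intervals with a disproportionately large contribution; repeating the corresponding
spike very often, but on a set of small measure, would give functions that converge to a constant
with respect to \<open>\<tau>\<close> while the valuation blows up (\<open>climb_local_Lipschitz\<close>). An additive Lipschitz function
of intervals has a density (\<open>Lipschitz_density\<close>, by Radon-Nikodym), and \<open>K s \<gamma>\<close> is \<open>2\<pi>\<gamma>\<close> times the density of
\<open>climb \<gamma>\<close> at \<open>s\<close>, while \<open>K s 0\<close> is the value on the constant \<open>s\<close>. A linear change of variables on
each piece turns the sum of contributions into the integral (\<open>integral_kernel_piecewise_affine\<close>).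

\<^bold>\<open>The measure.\<close> It remains to identify the normalized Hausdorff measure with the image of the uniform
distribution on \<open>[0, 2\<pi>)\<close> under \<open>cis\<close> (\<open>H1_eq\<close>). The statement on limits is \<open>\<tau>\<close>-continuity applied to
the integral formula.\<close>

section \<open>One-dimensional Hausdorff measure on the circle\<close>

lemma norm_cis_diff: "norm (cis a - cis b) = 2 * \<bar>sin ((a - b) / 2)\<bar>"
proof (rule power2_eq_imp_eq)
  have "(norm (cis a - cis b))\<^sup>2 = (cos a - cos b)\<^sup>2 + (sin a - sin b)\<^sup>2"
    by (simp add: cmod_power2)
  also have "\<dots> = 2 - 2 * cos (a - b)"
    using sin_cos_squared_add[of a] sin_cos_squared_add[of b]
    by (simp add: cos_diff power2_eq_square algebra_simps)
  also have "\<dots> = (2 * \<bar>sin ((a - b) / 2)\<bar>)\<^sup>2"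
  proof -
    have "2 * ((a - b) / 2) = a - b" by simp
    then have "cos (a - b) = 1 - 2 * (sin ((a - b) / 2))\<^sup>2" by (metis cos_double_sin)
    then show ?thesis by (simp add: power_mult_distrib)
  qed
  finally show "(norm (cis a - cis b))\<^sup>2 = (2 * \<bar>sin ((a - b) / 2)\<bar>)\<^sup>2" .
qed auto

lemma dist_cis_le: "dist (cis a) (cis b) \<le> \<bar>a - b\<bar>"
  using abs_sin_x_le_abs_x[of "(a - b) / 2"] by (simp add: dist_norm norm_cis_diff)

lemma abs_sin_half_abs: "\<bar>sin (\<bar>x\<bar> / 2)\<bar> = \<bar>sin (x / 2)\<bar>" for x :: real
proof (cases "0 \<le> x")
  case False
  then have "\<bar>x\<bar> / 2 = - (x / 2)" by simp
  then show ?thesis by (simp only: sin_minus abs_minus_cancel)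
qed simp

lemma sin_ge_mult_cos:
  assumes "0 \<le> y" "y \<le> pi"
  shows "y * cos y \<le> sin y"
proof (cases "y = 0")
  case False
  then have "\<exists>z>0. z < y \<and> sin y - sin 0 = (y - 0) * cos z"
    using assms by (intro MVT2) (auto intro!: derivative_eq_intros)
  then obtain z where "0 < z" "z < y" "sin y = y * cos z" by auto
  moreover have "cos y \<le> cos z" using calculation assms by (intro cos_monotone_0_pi_le) auto
  ultimately show ?thesis using assms by (simp add: mult_left_mono)
qed simp

text \<open>Chords of short arcs are almost as long as the arcs. The factor \<open>cos (d / 2)\<close> tends to \<open>1\<close> as the
arc length bound \<open>d\<close> tends to \<open>0\<close>.\<close>

lemma dist_cis_ge_mult_cos:
  assumes "\<bar>a - b\<bar> \<le> d" "d \<le> pi"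
  shows "\<bar>a - b\<bar> * cos (d / 2) \<le> dist (cis a) (cis b)"
proof -
  define y where "y = \<bar>a - b\<bar> / 2"
  have y: "0 \<le> y" "y \<le> d / 2" "y \<le> pi" using assms by (auto simp: y_def)
  have "\<bar>sin ((a - b) / 2)\<bar> = sin y"
    using abs_sin_half_abs[of "a - b"] sin_ge_zero[OF y(1,3)] by (simp add: y_def)
  moreover have "y * cos (d / 2) \<le> y * cos y"
    using y assms by (intro mult_left_mono cos_monotone_0_pi_le) auto
  ultimately have "2 * y * cos (d / 2) \<le> 2 * \<bar>sin ((a - b) / 2)\<bar>"
    using sin_ge_mult_cos[OF y(1,3)] by simp
  then show ?thesis by (simp add: dist_norm norm_cis_diff y_def)
qed

text \<open>Unlike \<open>dist_cis_ge_mult_cos\<close> this gives a positive factor up to arcs of length \<open>\<pi>\<close>; the double angle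
formula reduces it to angles at most \<open>\<pi> / 4\<close>, where the cosine is at least \<open>1 / \<surd>2\<close>.\<close>

lemma dist_cis_ge_half:
  assumes "\<bar>a - b\<bar> \<le> pi"
  shows "\<bar>a - b\<bar> / 2 \<le> dist (cis a) (cis b)"
proof -
  define y where "y = \<bar>a - b\<bar> / 4"
  have y: "0 \<le> y" "y \<le> pi / 4" using assms by (auto simp: y_def)
  have c: "sqrt 2 / 2 \<le> cos y"
    using cos_monotone_0_pi_le[OF y] by (simp add: cos_45)
  have "0 \<le> sqrt 2 / 2" by simp
  with c have c0: "0 \<le> cos y" by linarith
  have "1 / 2 = (sqrt 2 / 2) * (sqrt 2 / 2)" by simp
  also have "\<dots> \<le> cos y * cos y" using c c0 by (intro mult_mono) auto
  finally have "y \<le> 2 * (y * cos y * cos y)"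
    using mult_left_mono[of "1 / 2" "cos y * cos y" y] y by simp
  also have "\<dots> \<le> 2 * (sin y * cos y)"
    using sin_ge_mult_cos[of y] y c0 by (intro mult_left_mono mult_right_mono) auto
  also have "\<dots> = sin (2 * y)" by (simp add: sin_double)
  finally have "2 * y \<le> 2 * \<bar>sin (2 * y)\<bar>" by simp
  also have "\<bar>sin (2 * y)\<bar> = \<bar>sin ((a - b) / 2)\<bar>"
    using abs_sin_half_abs[of "a - b"] by (simp add: y_def)
  finally show ?thesis by (simp add: dist_norm norm_cis_diff y_def)
qed

lemma cis_add_2pi: "cis (t + 2 * pi) = cis t"
  by (simp add: cis_mult[symmetric])

lemma cis_measurable [measurable]: "cis \<in> borel_measurable borel"
  by (intro borel_measurable_continuous_onI continuous_intros continuous_on_cis continuous_on_id)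

lemma arc_preimage_measurable:
  assumes [measurable]: "X \<in> sets borel"
  shows "{t \<in> {x..<y}. cis t \<in> X} \<in> sets borel"
  by measurable

text \<open>Lebesgue measure of a \<open>2\<pi>\<close>-periodic set in a window of length \<open>2\<pi>\<close> is independent of the window,
because the part that sticks out can be translated back by one period.\<close>

lemma emeasure_period_window:
  assumes X: "X \<in> sets borel" and a: "0 \<le> a" "a \<le> 2 * pi"
  shows "emeasure lborel {t \<in> {a..<a + 2 * pi}. cis t \<in> X} = emeasure lborel {t \<in> {0..<2 * pi}. cis t \<in> X}"
proof -
  define P where "P x y = {t \<in> {x..<y}. cis t \<in> X}" for x y
  have m: "P x y \<in> sets lborel" for x y using arc_preimage_measurable[OF X] by (simp only: P_def sets_lborel)
  have "(+) (2 * pi) -` P (2 * pi) (a + 2 * pi) \<inter> space lborel = P 0 a"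
    using cis_add_2pi by (auto simp: P_def add.commute[of "2 * pi"])
  then have "emeasure (distr lborel borel ((+) (2 * pi))) (P (2 * pi) (a + 2 * pi)) = emeasure lborel (P 0 a)"
    using m by (subst emeasure_distr) auto
  then have shift: "emeasure lborel (P (2 * pi) (a + 2 * pi)) = emeasure lborel (P 0 a)"
    by (simp only: lborel_distr_plus)
  have "P a (a + 2 * pi) = P a (2 * pi) \<union> P (2 * pi) (a + 2 * pi)" using a by (auto simp: P_def)
  also have "emeasure lborel \<dots> = emeasure lborel (P a (2 * pi)) + emeasure lborel (P (2 * pi) (a + 2 * pi))"
    by (intro plus_emeasure[symmetric] m) (auto simp: P_def)
  also have "\<dots> = emeasure lborel (P 0 a) + emeasure lborel (P a (2 * pi))"
    by (simp only: shift add.commute)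
  also have "\<dots> = emeasure lborel (P 0 a \<union> P a (2 * pi))"
    by (intro plus_emeasure m) (auto simp: P_def)
  also have "P 0 a \<union> P a (2 * pi) = P 0 (2 * pi)" using a by (auto simp: P_def)
  finally show ?thesis by (simp only: P_def)
qed

text \<open>A small set lies in an arc that is hardly longer than its diameter. The window is chosen such that the
set sits in its middle; otherwise the preimage could split into a part near \<open>0\<close> and a part near
\<open>2\<pi>\<close>.\<close>

lemma emeasure_small_set:
  assumes U: "bounded U" "diameter U \<le> \<delta>" and \<delta>: "0 < \<delta>" "\<delta> < pi / 8"
  shows "ennreal (cos (2 * \<delta>)) * emeasure lborel {t \<in> {0..<2 * pi}. cis t \<in> closure U} \<le> ennreal (diameter U)"
proof (cases "\<exists>t\<in>{0..<2 * pi}. cis t \<in> closure U")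
  case False
  then have "{t \<in> {0..<2 * pi}. cis t \<in> closure U} = {}" by blast
  then show ?thesis by (simp only: emeasure_empty mult_zero_right zero_le)
next
  case True
  then obtain t0 where t0: "0 \<le> t0" "t0 < 2 * pi" "cis t0 \<in> closure U" by auto
  \<comment> \<open>The window \<open>[a, a + 2\<pi>)\<close> has a point over \<open>cis t0\<close> in its middle and meets the range of \<open>emeasure_period_window\<close>.\<close>
  define a where "a = (if pi \<le> t0 then t0 - pi else t0 + pi)"
  have a: "0 \<le> a" "a \<le> 2 * pi" using t0 by (auto simp: a_def)
  have mid: "cis (a + pi) \<in> closure U"
    using t0 cis_add_2pi[of t0] by (simp add: a_def add.assoc)
  have near: "dist x y \<le> diameter U" if "x \<in> closure U" "y \<in> closure U" for x y
    using diameter_bounded_bound[of "closure U" x y] that U(1) by (simp add: diameter_closure bounded_closure)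
  have cos: "0 < cos (2 * \<delta>)" using \<delta> by (intro cos_gt_zero) auto
  let ?S = "{t \<in> {a..<a + 2 * pi}. cis t \<in> closure U}"
  have close: "\<bar>t - (a + pi)\<bar> \<le> 2 * \<delta>" if "t \<in> ?S" for t
  proof -
    have "\<bar>t - (a + pi)\<bar> \<le> pi" using that by (simp add: abs_le_iff)
    then show ?thesis
      using dist_cis_ge_half[of t "a + pi"] near[of "cis t" "cis (a + pi)"] that mid U(2) by auto
  qed
  have pair: "\<bar>t - s\<bar> * cos (2 * \<delta>) \<le> diameter U" if "t \<in> ?S" "s \<in> ?S" for s t
  proof -
    have "\<bar>t - s\<bar> \<le> 4 * \<delta>" using close[OF that(1)] close[OF that(2)] by linarith
    then show ?thesis using dist_cis_ge_mult_cos[of t s "4 * \<delta>"] near[of "cis t" "cis s"] that \<delta> by auto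
  qed
  have "a + pi \<in> ?S" using mid by auto
  then have ne: "?S \<noteq> {}" by blast
  have bdd: "bdd_below ?S" by (auto simp: bdd_below_def)
  define r where "r = diameter U / cos (2 * \<delta>)"
  have sub: "?S \<subseteq> {Inf ?S..Inf ?S + r}"
  proof
    fix t assume t: "t \<in> ?S"
    have "t - r \<le> Inf ?S"
    proof (rule cInf_greatest[OF ne])
      fix s assume "s \<in> ?S"
      then have "\<bar>t - s\<bar> * cos (2 * \<delta>) \<le> diameter U" by (rule pair[OF t])
      moreover have "(t - s) * cos (2 * \<delta>) \<le> \<bar>t - s\<bar> * cos (2 * \<delta>)"
        using cos by (intro mult_right_mono) auto
      ultimately have "(t - s) * cos (2 * \<delta>) \<le> diameter U" by linarith
      then have "t - s \<le> r" unfolding r_def using cos by (simp add: pos_le_divide_eq)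
      then show "t - r \<le> s" by simp
    qed
    moreover have "Inf ?S \<le> t" using t bdd by (rule cInf_lower)
    ultimately show "t \<in> {Inf ?S..Inf ?S + r}" by auto
  qed
  have r0: "0 \<le> r" unfolding r_def using cos diameter_ge_0[OF U(1)] by simp
  have "emeasure lborel ?S \<le> emeasure lborel {Inf ?S..Inf ?S + r}" using sub by (intro emeasure_mono) auto
  also have "\<dots> = ennreal r" using r0 by simp
  finally have "ennreal (cos (2 * \<delta>)) * emeasure lborel ?S \<le> ennreal (cos (2 * \<delta>)) * ennreal r"
    by (intro mult_left_mono) auto
  also have "\<dots> = ennreal (diameter U)"
    using cos r0 by (simp add: r_def flip: ennreal_mult)
  finally show ?thesis using emeasure_period_window[OF _ a, of "closure U"] by (simp only: borel_closed closed_closure)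
qed

text \<open>Each member of a cover by small sets has at least as large a diameter as the Lebesgue measure of its
preimage, up to the factor \<open>cos (2 * \<delta>)\<close>, which disappears as \<open>\<delta>\<close> tends to \<open>0\<close>.\<close>

lemma hausdorff1_ge:
  assumes A: "A \<subseteq> S1" and m: "{t \<in> {0..<2 * pi}. cis t \<in> A} \<in> sets borel"
  shows "emeasure lborel {t \<in> {0..<2 * pi}. cis t \<in> A} \<le> hausdorff1 A"
proof -
  let ?B = "{t \<in> {0..<2 * pi}. cis t \<in> A}"
  have le: "ennreal (cos (2 * \<delta>)) * emeasure lborel ?B \<le> hausdorff1 A" if \<delta>: "0 < \<delta>" "\<delta> < pi / 8" for \<delta>
  proof -
    have "ennreal (cos (2 * \<delta>)) * emeasure lborel ?B \<le> hausdorff1_delta \<delta> A"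
      unfolding hausdorff1_delta_def
    proof (rule INF_greatest, clarify)
      fix U :: "nat \<Rightarrow> complex set"
      assume cov: "A \<subseteq> (\<Union>i. U i)" and U: "\<forall>i. bounded (U i) \<and> diameter (U i) \<le> \<delta>"
      let ?C = "\<lambda>i. {t \<in> {0..<2 * pi}. cis t \<in> closure (U i)}"
      have C: "?C i \<in> sets lborel" for i using arc_preimage_measurable[of "closure (U i)"] by simp
      have "?B \<subseteq> (\<Union>i. ?C i)"
      proof
        fix t assume t: "t \<in> ?B"
        then obtain i where "cis t \<in> U i" using cov by blast
        then have "cis t \<in> closure (U i)" using closure_subset by blast
        with t show "t \<in> (\<Union>i. ?C i)" by blast
      qed
      then have "emeasure lborel ?B \<le> emeasure lborel (\<Union>i. ?C i)" using C by (intro emeasure_mono) auto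
      also have "\<dots> \<le> (\<Sum>i. emeasure lborel (?C i))" by (rule emeasure_subadditive_countably) (use C in blast)
      finally have "ennreal (cos (2 * \<delta>)) * emeasure lborel ?B \<le> ennreal (cos (2 * \<delta>)) * (\<Sum>i. emeasure lborel (?C i))"
        by (intro mult_left_mono) auto
      also have "\<dots> = (\<Sum>i. ennreal (cos (2 * \<delta>)) * emeasure lborel (?C i))" by simp
      also have "\<dots> \<le> (\<Sum>i. ennreal (diameter (U i)))"
        using U \<delta> by (intro suminf_le emeasure_small_set) auto
      finally show "ennreal (cos (2 * \<delta>)) * emeasure lborel ?B \<le> (\<Sum>i. ennreal (diameter (U i)))" .
    qed
    also have "\<dots> \<le> hausdorff1 A" unfolding hausdorff1_def using \<delta> by (intro SUP_upper) auto
    finally show ?thesis .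
  qed
  have "emeasure lborel ?B \<le> emeasure lborel {0..<2 * pi}" using m by (intro emeasure_mono) auto
  then have fin: "emeasure lborel ?B < \<infinity>" by (rule le_less_trans) simp
  show ?thesis
  proof (cases "hausdorff1 A")
    case (real h)
    define b where "b = measure lborel ?B"
    have b: "emeasure lborel ?B = ennreal b" "0 \<le> b"
      unfolding b_def using fin by (auto simp: emeasure_eq_ennreal_measure)
    have "(\<lambda>n. cos (2 * (1 / real (Suc n))) * b) \<longlonglongrightarrow> cos (2 * 0) * b"
      using LIMSEQ_inverse_real_of_nat by (intro tendsto_intros) (simp add: inverse_eq_divide)
    moreover have "\<forall>\<^sub>F n in sequentially. cos (2 * (1 / real (Suc n))) * b \<le> h"
    proof -
      have "\<forall>\<^sub>F n in sequentially. inverse (real (Suc n)) < pi / 8"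
        using LIMSEQ_inverse_real_of_nat by (rule order_tendstoD) simp
      then show ?thesis
      proof eventually_elim
        case (elim n)
        then have d: "0 < 1 / real (Suc n)" "1 / real (Suc n) < pi / 8" by (auto simp: inverse_eq_divide)
        have "0 \<le> cos (2 * (1 / real (Suc n)))"
        proof (intro less_imp_le cos_gt_zero)
          show "0 < 2 * (1 / real (Suc n))" "2 * (1 / real (Suc n)) < pi / 2" using d by linarith+
        qed
        then show ?case using le[OF d] real b by (simp add: ennreal_le_iff flip: ennreal_mult)
      qed
    qed
    ultimately have "b \<le> h" using tendsto_upperbound[of _ "cos (2 * 0) * b" sequentially h] by simp
    then show ?thesis using real b by (simp add: ennreal_leI)
  next
    case top
    then show ?thesis by simp
  qed
qed

text \<open>Since \<open>cis\<close> does not increase distances, covers of the preimage by short intervals give covers of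
the set. Almost optimal ones come from an open superset and the covering lemma, applied to a gauge
that keeps the intervals inside the open set and shorter than \<open>\<delta>\<close>.\<close>

lemma hausdorff1_le:
  assumes A: "A \<subseteq> S1" and m: "{t \<in> {0..<2 * pi}. cis t \<in> A} \<in> sets borel"
  shows "hausdorff1 A \<le> emeasure lborel {t \<in> {0..<2 * pi}. cis t \<in> A}"
proof (rule ennreal_le_epsilon)
  define B where "B = {t \<in> {0..<2 * pi}. cis t \<in> A}"
  have m: "B \<in> sets lborel" using m by (simp only: B_def sets_lborel)
  fix e :: real assume e: "0 < e"
  have "B \<in> sets lebesgue" using m by (rule sets_completionI_sets)
  then obtain T where T: "open T" "B \<subseteq> T" "T - B \<in> lmeasurable" "emeasure lebesgue (T - B) < ennreal e"
    by (rule sets_lebesgue_outer_open[OF _ e])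
  have TB: "emeasure lborel T \<le> emeasure lborel B + ennreal e"
  proof -
    have d: "T - B \<in> sets lborel" using T(1) m by auto
    then have "emeasure lborel (T - B) \<le> ennreal e" using T(4) by (simp add: less_imp_le)
    moreover have "emeasure lborel T \<le> emeasure lborel B + emeasure lborel (T - B)"
    proof -
      have "T = B \<union> (T - B)" using T(2) by blast
      then show ?thesis
        using emeasure_subadditive[OF m d] by (simp only:)
    qed
    ultimately show ?thesis using add_left_mono order_trans by blast
  qed
  have "hausdorff1_delta \<delta> A \<le> emeasure lborel T" if \<delta>: "0 < \<delta>" for \<delta>
  proof -
    define g where "g x = (if x \<in> T then T \<inter> ball x (\<delta> / 2) else ball x 1)" for x :: real
    have g: "gauge g" using T(1) \<delta> unfolding gauge_def g_def by auto
    have "B \<subseteq> cbox 0 (2 * pi)" "box 0 (2 * pi) \<noteq> {}" using pi_gt_zero by (auto simp: B_def simp del: pi_gt_zero)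
    then obtain D where D: "countable D"
      "\<Union>D \<subseteq> cbox 0 (2 * pi)"
      "\<And>K. K \<in> D \<Longrightarrow> interior K \<noteq> {} \<and> (\<exists>c d. K = cbox c d)"
      "pairwise (\<lambda>A B. interior A \<inter> interior B = {}) D"
      "\<And>K. K \<in> D \<Longrightarrow> \<exists>x \<in> B \<inter> K. K \<subseteq> g x"
      "B \<subseteq> \<Union>D"
      by (rule covering_lemma[OF _ _ g]) (rule that)
    have small: "K \<subseteq> T" "\<And>s t. s \<in> K \<Longrightarrow> t \<in> K \<Longrightarrow> \<bar>s - t\<bar> \<le> \<delta>" if K: "K \<in> D" for K
    proof -
      obtain x where x: "x \<in> B \<inter> K" "K \<subseteq> g x" using D(5)[OF K] by blast
      then have "x \<in> T" using T(2) by blast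
      then have sub: "K \<subseteq> T \<inter> ball x (\<delta> / 2)" using x(2) by (simp add: g_def)
      then show "K \<subseteq> T" by blast
      fix s t assume "s \<in> K" "t \<in> K"
      then have "dist x s < \<delta> / 2" "dist x t < \<delta> / 2" using sub by auto
      then show "\<bar>s - t\<bar> \<le> \<delta>" unfolding dist_real_def by linarith
    qed
    have diam: "ennreal (diameter (cis ` K)) \<le> emeasure lborel (interior K)" if "K \<in> D" for K
    proof -
      obtain c d where K: "K = cbox c d" "interior K \<noteq> {}" using D(3)[OF \<open>K \<in> D\<close>] by blast
      then have cd: "c < d" "interior K = {c<..<d}" by auto
      have "norm (x - y) \<le> d - c" if xy: "x \<in> cis ` K" "y \<in> cis ` K" for x y
      proof -
        obtain s t where "x = cis s" "y = cis t" "s \<in> K" "t \<in> K" using xy by blast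
        then show ?thesis using dist_cis_le[of s t] K(1) by (auto simp: dist_norm)
      qed
      then have "diameter (cis ` K) \<le> d - c" using cd by (intro diameter_le) auto
      then show ?thesis using cd by (simp add: ennreal_leI)
    qed
    \<comment> \<open>The countable family \<open>D\<close> may be finite, so its enumeration is padded with empty sets.\<close>
    define k where "k i = (if i \<in> to_nat_on D ` D then inv_into D (to_nat_on D) i else {})" for i
    have k: "k i \<in> D \<or> k i = {}" for i
      unfolding k_def by (auto intro: inv_into_into)
    have k_to_nat: "k (to_nat_on D K) = K" if "K \<in> D" for K
      using that D(1) by (simp add: k_def inj_on_to_nat_on)
    have disj: "disjoint_family (\<lambda>i. interior (k i))"
      unfolding disjoint_family_on_def
    proof (intro ballI impI)
      fix i j :: nat assume ij: "i \<noteq> j"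
      show "interior (k i) \<inter> interior (k j) = {}"
      proof (cases "i \<in> to_nat_on D ` D \<and> j \<in> to_nat_on D ` D")
        case True
        then obtain K L where KL: "K \<in> D" "L \<in> D" "i = to_nat_on D K" "j = to_nat_on D L" by blast
        then have "K \<noteq> L" using ij by blast
        then show ?thesis using D(4) KL k_to_nat by (simp add: pairwise_def)
      next
        case False
        then show ?thesis by (auto simp: k_def)
      qed
    qed
    have "hausdorff1_delta \<delta> A \<le> (\<Sum>i. ennreal (diameter (cis ` k i)))"
      unfolding hausdorff1_delta_def
    proof (rule INF_lower, intro CollectI conjI allI)
      show "A \<subseteq> (\<Union>i. cis ` k i)"
      proof
        fix x assume x: "x \<in> A"
        then have "norm x = 1" using A by auto
        then have "cis (Arg2pi x) = x" by (simp add: cis_conv_exp complex_norm_eq_1_exp)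
        then have "Arg2pi x \<in> B" using x Arg2pi[of x] by (simp add: B_def)
        then obtain K where "K \<in> D" "Arg2pi x \<in> K" using D(6) by blast
        then have "x \<in> cis ` k (to_nat_on D K)"
          using k_to_nat \<open>cis (Arg2pi x) = x\<close> by force
        then show "x \<in> (\<Union>i. cis ` k i)" by blast
      qed
      fix i
      show "bounded (cis ` k i)" by (intro boundedI[of _ 1]) auto
      show "diameter (cis ` k i) \<le> \<delta>"
      proof (rule diameter_le)
        fix x y assume "x \<in> cis ` k i" "y \<in> cis ` k i"
        then obtain s t where st: "x = cis s" "y = cis t" "s \<in> k i" "t \<in> k i" by blast
        then have "\<bar>s - t\<bar> \<le> \<delta>" using small(2)[of "k i" s t] k[of i] by auto
        then show "norm (x - y) \<le> \<delta>" using dist_cis_le[of s t] st by (simp add: dist_norm)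
      qed (use \<delta> in auto)
    qed
    also have "\<dots> \<le> (\<Sum>i. emeasure lborel (interior (k i)))"
    proof (rule suminf_le)
      show "ennreal (diameter (cis ` k i)) \<le> emeasure lborel (interior (k i))" for i
        using diam[of "k i"] k[of i] by auto
    qed auto
    also have "\<dots> = emeasure lborel (\<Union>i. interior (k i))"
      using disj by (intro suminf_emeasure) auto
    also have "\<dots> \<le> emeasure lborel T"
    proof (rule emeasure_mono)
      have "interior (k i) \<subseteq> T" for i using k[of i] small(1)[of "k i"] interior_subset[of "k i"] by auto
      then show "(\<Union>i. interior (k i)) \<subseteq> T" by blast
    qed (use T(1) in simp)
    finally show ?thesis .
  qed
  then have "hausdorff1 A \<le> emeasure lborel T" unfolding hausdorff1_def by (intro SUP_least) auto
  with TB show "hausdorff1 A \<le> emeasure lborel {t \<in> {0..<2 * pi}. cis t \<in> A} + ennreal e"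
    unfolding B_def by (rule order_trans[rotated])
qed

lemma cis_measurable_S1: "cis \<in> measurable borel (restrict_space borel S1)"
  by (intro measurable_restrict_space2) auto

lemma H1_eq: "H1 = distr (uniform_measure lborel {0..<2 * pi}) (restrict_space borel S1) cis"
proof -
  let ?R = "restrict_space borel S1 :: complex measure"
  define N where "N = distr (uniform_measure lborel {0..<2 * pi}) ?R cis"
  have N: "space N = S1" "sets N = sets ?R" by (simp_all add: N_def space_restrict_space)
  have cis: "cis \<in> measurable (uniform_measure lborel {0..<2 * pi}) ?R"
    using cis_measurable_S1 by (simp cong: measurable_cong_sets)
  have eq: "hausdorff1 A / hausdorff1 S1 = emeasure N A" if "A \<in> sets ?R" for A
  proof -
    have haus: "hausdorff1 X = emeasure lborel {t \<in> {0..<2 * pi}. cis t \<in> X}" if X: "X \<in> sets ?R" for X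
    proof -
      have XS: "X \<subseteq> S1" "X \<in> sets borel" using X by (auto simp: sets_restrict_space_iff)
      then show ?thesis
        using arc_preimage_measurable[OF XS(2)] by (intro antisym hausdorff1_le hausdorff1_ge)
    qed
    have AB: "A \<in> sets borel" using that by (auto simp: sets_restrict_space_iff)
    have "emeasure N A = emeasure (uniform_measure lborel {0..<2 * pi}) (cis -` A)"
      unfolding N_def using that by (subst emeasure_distr[OF cis]) auto
    also have "\<dots> = emeasure lborel ({0..<2 * pi} \<inter> cis -` A) / emeasure lborel {0..<2 * pi}"
      using measurable_sets[OF cis_measurable AB] by (intro emeasure_uniform_measure) auto
    also have "{0..<2 * pi} \<inter> cis -` A = {t \<in> {0..<2 * pi}. cis t \<in> A}" by auto
    also have "emeasure lborel {0..<2 * pi} = hausdorff1 S1"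
    proof -
      have "S1 \<in> sets ?R" by (simp add: sets_restrict_space_iff)
      moreover have "{t \<in> {0..<2 * pi}. cis t \<in> S1} = {0..<2 * pi}" by auto
      ultimately show ?thesis using haus by (simp only:)
    qed
    finally show ?thesis using haus[OF that] by (simp only:)
  qed
  have "H1 = measure_of S1 (sets ?R) (emeasure N)"
    unfolding H1_def
  proof (rule measure_of_eq)
    show "sets ?R \<subseteq> Pow S1" using sets.sets_into_space[of _ ?R] by (auto simp: space_restrict_space)
    show "hausdorff1 a / hausdorff1 S1 = emeasure N a" if "a \<in> sigma_sets S1 (sets ?R)" for a
      using that sets.sigma_sets_eq[of ?R] by (intro eq) (simp add: space_restrict_space)
  qed
  also have "\<dots> = N" using measure_of_of_measure[of N] unfolding N .
  finally show ?thesis by (simp only: N_def)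
qed

section \<open>Upper envelopes of cones\<close>

definition periodic_Lip :: "(real \<Rightarrow> real) set" where
  "periodic_Lip = {f. (\<forall>t. f (t + 2 * pi) = f t) \<and> (\<exists>L. L-lipschitz_on UNIV f)}"

text \<open>The least function that lies above \<open>c\<close> and above every downward cone of slope \<open>l\<close> with apex on the
graph of \<open>f\<close> over \<open>E\<close>. When \<open>f\<close> is \<open>l\<close>-Lipschitz, it is the smallest \<open>l\<close>-Lipschitz extension of \<open>f\<close>
from \<open>E\<close> (McShane's extension), cut off at the floor \<open>c\<close>. The floor is part of the supremum so that
the empty set is covered as well.\<close>

definition cones :: "real \<Rightarrow> real \<Rightarrow> real set \<Rightarrow> (real \<Rightarrow> real) \<Rightarrow> real \<Rightarrow> real" where
  "cones c l E f t = Sup (insert c ((\<lambda>s. f s - l * \<bar>t - s\<bar>) ` E))"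

lemma periodic_int:
  fixes f :: "real \<Rightarrow> 'a"
  assumes "\<And>t. f (t + 2 * pi) = f t"
  shows "f (t + 2 * pi * of_int k) = f t"
proof (induction k rule: int_induct[where k = 0])
  case (step1 i)
  then show ?case using assms[of "t + 2 * pi * of_int i"] by (simp add: algebra_simps)
next
  case (step2 i)
  then show ?case using assms[of "t + 2 * pi * of_int (i - 1)"] by (simp add: algebra_simps)
qed simp

lemma cones_bdd:
  fixes l t :: real and f :: "real \<Rightarrow> real"
  assumes "bdd_above (f ` E)" "0 \<le> l"
  shows "bdd_above (insert c ((\<lambda>s. f s - l * \<bar>t - s\<bar>) ` E))"
proof -
  obtain M where M: "\<And>s. s \<in> E \<Longrightarrow> f s \<le> M" using assms(1) by (auto simp: bdd_above_def)
  have "f s - l * \<bar>t - s\<bar> \<le> M" if "s \<in> E" for s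
    using M[OF that] mult_nonneg_nonneg[OF assms(2), of "\<bar>t - s\<bar>"] by simp
  then show ?thesis by (simp add: bdd_above_insert) (auto simp: bdd_above_def)
qed

lemma cones_le_iff:
  assumes "bdd_above (f ` E)" "0 \<le> l"
  shows "cones c l E f t \<le> z \<longleftrightarrow> c \<le> z \<and> (\<forall>s\<in>E. f s - l * \<bar>t - s\<bar> \<le> z)"
  unfolding cones_def using cSup_le_iff[OF _ cones_bdd[OF assms]] by (subst cSup_le_iff[OF _ cones_bdd[OF assms]]) auto

lemma cones_ge:
  assumes "bdd_above (f ` E)" "0 \<le> l"
  shows "c \<le> cones c l E f t" "s \<in> E \<Longrightarrow> f s - l * \<bar>t - s\<bar> \<le> cones c l E f t"
  using cones_le_iff[OF assms, of c t "cones c l E f t"] by auto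

lemma cones_empty [simp]: "cones c l {} f = (\<lambda>_. c)"
  by (simp add: cones_def fun_eq_iff)

lemma cones_cong: "(\<And>s. s \<in> E \<Longrightarrow> f s = g s) \<Longrightarrow> cones c l E f = cones c l E g"
  by (simp add: cones_def fun_eq_iff cong: image_cong)

lemma cones_Un:
  assumes "bdd_above (f ` E)" "bdd_above (f ` F)" "0 \<le> l"
  shows "cones c l (E \<union> F) f t = max (cones c l E f t) (cones c l F f t)"
proof -
  have b: "bdd_above (f ` (E \<union> F))" using assms by (simp add: image_Un)
  show ?thesis
  proof (rule antisym)
    show "cones c l (E \<union> F) f t \<le> max (cones c l E f t) (cones c l F f t)"
      unfolding cones_le_iff[OF b assms(3)]
      using cones_ge[OF assms(1,3)] cones_ge[OF assms(2,3)] by (force simp: le_max_iff_disj)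
    show "max (cones c l E f t) (cones c l F f t) \<le> cones c l (E \<union> F) f t"
      using cones_ge[OF b assms(3)] by (auto simp: cones_le_iff assms)
  qed
qed

text \<open>Of two cones with apices \<open>e\<close> and \<open>q\<close>, one is at any given point below the envelope of the
intersection: if some \<open>p\<close> of the intersection separates \<open>e\<close> from \<open>q\<close>, then the apex that is
separated by \<open>p\<close> from the point can be replaced with \<open>p\<close>, as \<open>f\<close> is \<open>l\<close>-Lipschitz; and if \<open>e\<close> and
\<open>q\<close> are far apart, then the cones do not meet above the floor.\<close>

lemma cones_Int:
  assumes bE: "bdd_above (f ` E)" and bF: "bdd_above (f ` F)"
    and lip: "l-lipschitz_on UNIV f"
    and sep: "\<And>e q. e \<in> E \<Longrightarrow> q \<in> F \<Longrightarrow>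
      (\<exists>p\<in>E \<inter> F. e \<le> p \<and> p \<le> q \<or> q \<le> p \<and> p \<le> e) \<or> f e + f q \<le> 2 * c + l * \<bar>e - q\<bar>"
  shows "cones c l (E \<inter> F) f t = min (cones c l E f t) (cones c l F f t)"
proof -
  have l: "0 \<le> l" using lip by (simp add: lipschitz_on_def)
  have lip': "f x - f y \<le> l * \<bar>x - y\<bar>" for x y
    using lipschitz_onD[OF lip, of x y] by (simp add: dist_real_def)
  have b: "bdd_above (f ` (E \<inter> F))" using bE by (rule bdd_above_mono) auto
  have key: "f e - l * \<bar>t - e\<bar> \<le> cones c l (E \<inter> F) f t \<or> f q - l * \<bar>t - q\<bar> \<le> cones c l (E \<inter> F) f t"
    if e: "e \<in> E" and q: "q \<in> F" for e q
    using sep[OF e q]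
  proof
    assume "\<exists>p\<in>E \<inter> F. e \<le> p \<and> p \<le> q \<or> q \<le> p \<and> p \<le> e"
    then obtain p where p: "p \<in> E \<inter> F" and or: "e \<le> p \<and> p \<le> q \<or> q \<le> p \<and> p \<le> e" by blast
    have far: "f x - l * \<bar>t - x\<bar> \<le> f p - l * \<bar>t - p\<bar>" if "\<bar>t - x\<bar> = \<bar>t - p\<bar> + \<bar>x - p\<bar>" for x
      using lip'[of x p] unfolding that by (simp add: algebra_simps)
    have "\<bar>t - e\<bar> = \<bar>t - p\<bar> + \<bar>e - p\<bar> \<or> \<bar>t - q\<bar> = \<bar>t - p\<bar> + \<bar>q - p\<bar>"
      using or by linarith
    then show ?thesis using far cones_ge(2)[OF b l p, of t c] by force
  next
    assume gap: "f e + f q \<le> 2 * c + l * \<bar>e - q\<bar>"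
    have "l * \<bar>e - q\<bar> \<le> l * \<bar>t - e\<bar> + l * \<bar>t - q\<bar>"
      using mult_left_mono[OF _ l, of "\<bar>e - q\<bar>" "\<bar>t - e\<bar> + \<bar>t - q\<bar>"] by (simp add: algebra_simps)
    then show ?thesis using gap cones_ge(1)[OF b l, of c t] by linarith
  qed
  show ?thesis
  proof (rule antisym)
    show "cones c l (E \<inter> F) f t \<le> min (cones c l E f t) (cones c l F f t)"
      unfolding cones_le_iff[OF b l] using cones_ge[OF bE l] cones_ge[OF bF l] by auto
    show "min (cones c l E f t) (cones c l F f t) \<le> cones c l (E \<inter> F) f t"
    proof (cases "\<forall>e\<in>E. f e - l * \<bar>t - e\<bar> \<le> cones c l (E \<inter> F) f t")
      case True
      then have "cones c l E f t \<le> cones c l (E \<inter> F) f t"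
        using cones_ge(1)[OF b l] by (simp add: cones_le_iff[OF bE l])
      then show ?thesis by simp
    next
      case False
      then have "\<forall>q\<in>F. f q - l * \<bar>t - q\<bar> \<le> cones c l (E \<inter> F) f t" using key by blast
      then have "cones c l F f t \<le> cones c l (E \<inter> F) f t"
        using cones_ge(1)[OF b l] by (simp add: cones_le_iff[OF bF l])
      then show ?thesis by simp
    qed
  qed
qed

lemma cones_shift: "cones c l ((\<lambda>s. s + a) ` E) f t = cones c l E (\<lambda>s. f (s + a)) (t - a)"
  by (simp add: cones_def image_image algebra_simps)

lemma cones_reflect: "cones c l (uminus ` E) f t = cones c l E (\<lambda>s. f (- s)) (- t)"
proof -
  have "\<bar>t + s\<bar> = \<bar>- t - s\<bar>" for s by linarith
  then show ?thesis by (simp add: cones_def image_image)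
qed

lemma cones_lipschitz:
  assumes "bdd_above (f ` E)" "0 \<le> l"
  shows "l-lipschitz_on UNIV (cones c l E f)"
proof (rule lipschitz_onI)
  have *: "cones c l E f x \<le> cones c l E f y + l * \<bar>x - y\<bar>" for x y
    unfolding cones_le_iff[OF assms]
  proof (intro conjI ballI)
    show "c \<le> cones c l E f y + l * \<bar>x - y\<bar>"
      using cones_ge(1)[OF assms, of c y] mult_nonneg_nonneg[OF assms(2), of "\<bar>x - y\<bar>"] by simp
    fix s assume "s \<in> E"
    moreover have "l * \<bar>y - s\<bar> \<le> l * \<bar>x - s\<bar> + l * \<bar>x - y\<bar>"
      using mult_left_mono[OF _ assms(2), of "\<bar>y - s\<bar>" "\<bar>x - s\<bar> + \<bar>x - y\<bar>"] by (simp add: algebra_simps)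
    ultimately show "f s - l * \<bar>x - s\<bar> \<le> cones c l E f y + l * \<bar>x - y\<bar>"
      using cones_ge(2)[OF assms, of s y c] by linarith
  qed
  show "dist (cones c l E f x) (cones c l E f y) \<le> l * dist x y" for x y
    using *[of x y] *[of y x] by (simp add: dist_real_def abs_minus_commute)
qed (use assms in auto)

lemma cones_periodic:
  assumes "\<And>t. t + 2 * pi \<in> E \<longleftrightarrow> t \<in> E" "\<And>t. f (t + 2 * pi) = f t"
  shows "cones c l E f (t + 2 * pi) = cones c l E f t"
proof -
  have "E = (\<lambda>s. s + 2 * pi) ` E"
  proof (intro equalityI subsetI)
    show "s \<in> (\<lambda>s. s + 2 * pi) ` E" if "s \<in> E" for s
      using that assms(1)[of "s - 2 * pi"] by (intro image_eqI[where x = "s - 2 * pi"]) auto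
  qed (use assms(1) in auto)
  then have "cones c l E f (t + 2 * pi) = cones c l ((\<lambda>s. s + 2 * pi) ` E) f (t + 2 * pi)" by simp
  then show ?thesis by (simp add: cones_shift assms(2))
qed

lemma cones_UNIV:
  assumes "l-lipschitz_on UNIV f" "\<And>t. c \<le> f t" "bdd_above (range f)"
  shows "cones c l UNIV f = f"
proof
  fix t
  have l: "0 \<le> l" using assms(1) by (simp add: lipschitz_on_def)
  have lip': "f x - f y \<le> l * \<bar>x - y\<bar>" for x y
    using lipschitz_onD[OF assms(1), of x y] by (simp add: dist_real_def)
  show "cones c l UNIV f t = f t"
  proof (rule antisym)
    show "cones c l UNIV f t \<le> f t"
      using assms(2) lip'[of _ t] by (auto simp: cones_le_iff[OF assms(3) l] algebra_simps abs_minus_commute)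
    show "f t \<le> cones c l UNIV f t" using cones_ge(2)[OF assms(3) l, of t t c] by simp
  qed
qed

lemma cones_in_periodic_Lip:
  assumes "\<And>t. t + 2 * pi \<in> E \<longleftrightarrow> t \<in> E" "\<And>t. f (t + 2 * pi) = f t" "bdd_above (f ` E)" "0 \<le> l"
  shows "cones c l E f \<in> periodic_Lip"
  using cones_lipschitz[OF assms(3,4)] cones_periodic[of E f, OF assms(1,2)] by (auto simp: periodic_Lip_def)

text \<open>An arc of the circle is represented by its full periodic preimage in the line, so that the cones over
it spread both ways round the circle.\<close>

definition lifted_arc :: "real \<Rightarrow> real \<Rightarrow> real set" where
  "lifted_arc a b = {t. \<exists>k::int. a + 2 * pi * of_int k \<le> t \<and> t \<le> b + 2 * pi * of_int k}"

lemma turns_mono: "j < k \<Longrightarrow> 2 * pi * of_int j + 2 * pi \<le> 2 * pi * real_of_int k"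
proof -
  assume "j < k"
  then have "real_of_int j + 1 \<le> of_int k" by linarith
  then have "2 * pi * (real_of_int j + 1) \<le> 2 * pi * of_int k" by (intro mult_left_mono) auto
  then show ?thesis by (simp add: algebra_simps)
qed

lemma turns_mono': "j \<le> k \<Longrightarrow> 2 * pi * of_int j \<le> 2 * pi * real_of_int k"
  by simp

lemma turns_cases:
  "2 * pi * of_int k \<le> 2 * pi * real_of_int j \<or> 2 * pi * of_int j + 2 * pi \<le> 2 * pi * real_of_int k"
  using turns_mono[of j k] by (cases "k \<le> j") auto

lemma lifted_arc_periodic: "t + 2 * pi \<in> lifted_arc a b \<longleftrightarrow> t \<in> lifted_arc a b"
proof
  assume "t + 2 * pi \<in> lifted_arc a b"
  then obtain k :: int where "a + 2 * pi * of_int k \<le> t + 2 * pi" "t + 2 * pi \<le> b + 2 * pi * of_int k"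
    by (auto simp: lifted_arc_def)
  then show "t \<in> lifted_arc a b" unfolding lifted_arc_def by (intro CollectI exI[of _ "k - 1"]) (simp add: algebra_simps)
next
  assume "t \<in> lifted_arc a b"
  then obtain k :: int where "a + 2 * pi * of_int k \<le> t" "t \<le> b + 2 * pi * of_int k"
    by (auto simp: lifted_arc_def)
  then show "t + 2 * pi \<in> lifted_arc a b" unfolding lifted_arc_def by (intro CollectI exI[of _ "k + 1"]) (simp add: algebra_simps)
qed

lemma lifted_arc_shift: "lifted_arc (a + s) (b + s) = (\<lambda>t. t + s) ` lifted_arc a b"
proof -
  have "t \<in> lifted_arc (a + s) (b + s) \<longleftrightarrow> t - s \<in> lifted_arc a b" for t
    unfolding lifted_arc_def by (simp add: algebra_simps)
  then show ?thesis by (force intro: image_eqI[where x = "_ - s"])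
qed

lemma lifted_arc_reflect: "lifted_arc (- b) (- a) = uminus ` lifted_arc a b"
proof -
  have *: "- t \<in> lifted_arc a b" if t: "t \<in> lifted_arc (- b) (- a)" for t a b
  proof -
    obtain k :: int where "- b + 2 * pi * of_int k \<le> t" "t \<le> - a + 2 * pi * of_int k"
      using t unfolding lifted_arc_def by blast
    then show ?thesis unfolding lifted_arc_def by (intro CollectI exI[of _ "- k"]) simp
  qed
  show ?thesis
  proof (intro equalityI subsetI)
    show "t \<in> uminus ` lifted_arc a b" if "t \<in> lifted_arc (- b) (- a)" for t
      using *[OF that] by (intro image_eqI[where x = "- t"]) auto
    show "t \<in> lifted_arc (- b) (- a)" if "t \<in> uminus ` lifted_arc a b" for t
      using *[where a = "- b" and b = "- a"] that by auto
  qed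
qed

lemma lifted_arc_Un:
  assumes "a \<le> b" "b \<le> d"
  shows "lifted_arc a b \<union> lifted_arc b d = lifted_arc a d"
proof
  show "lifted_arc a b \<union> lifted_arc b d \<subseteq> lifted_arc a d" using assms unfolding lifted_arc_def by force
  show "lifted_arc a d \<subseteq> lifted_arc a b \<union> lifted_arc b d" unfolding lifted_arc_def using linear by fastforce
qed

lemma lifted_arc_full: "lifted_arc a (a + 2 * pi) = UNIV"
proof -
  have "t \<in> lifted_arc a (a + 2 * pi)" for t
  proof -
    define k where "k = \<lfloor>(t - a) / (2 * pi)\<rfloor>"
    have "of_int k \<le> (t - a) / (2 * pi)" "(t - a) / (2 * pi) < of_int k + 1" unfolding k_def by linarith+
    then have "2 * pi * of_int k \<le> t - a" "t - a \<le> 2 * pi * (of_int k + 1)"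
      by (simp_all add: field_simps)
    then show ?thesis unfolding lifted_arc_def by (intro CollectI exI[of _ k]) (simp add: algebra_simps)
  qed
  then show ?thesis by auto
qed

lemma lifted_arc_Int:
  assumes "a \<le> b" "b \<le> d" "d < a + 2 * pi"
  shows "lifted_arc a b \<inter> lifted_arc b d = lifted_arc b b"
proof
  show "lifted_arc b b \<subseteq> lifted_arc a b \<inter> lifted_arc b d" using assms unfolding lifted_arc_def by force
  show "lifted_arc a b \<inter> lifted_arc b d \<subseteq> lifted_arc b b"
  proof
    fix t assume "t \<in> lifted_arc a b \<inter> lifted_arc b d"
    then obtain k j :: int where
      k: "a + 2 * pi * of_int k \<le> t" "t \<le> b + 2 * pi * of_int k" and
      j: "b + 2 * pi * of_int j \<le> t" "t \<le> d + 2 * pi * of_int j"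
      by (auto simp: lifted_arc_def)
    have "j = k"
      using turns_mono[of j k] turns_mono[of k j] k j assms by (cases j k rule: linorder_cases) auto
    then show "t \<in> lifted_arc b b" using k j unfolding lifted_arc_def by (intro CollectI exI[of _ k]) auto
  qed
qed

text \<open>Two complementary half circles share both endpoints, which is why closing up the circle involves
two spikes rather than one.\<close>

lemma lifted_arc_Int_opposite:
  "lifted_arc a (a + pi) \<inter> lifted_arc (a + pi) (a + 2 * pi) = lifted_arc a a \<union> lifted_arc (a + pi) (a + pi)"
proof
  show "lifted_arc a a \<union> lifted_arc (a + pi) (a + pi) \<subseteq> lifted_arc a (a + pi) \<inter> lifted_arc (a + pi) (a + 2 * pi)"
  proof
    fix t assume t: "t \<in> lifted_arc a a \<union> lifted_arc (a + pi) (a + pi)"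
    have "t \<in> lifted_arc (a + pi) (a + 2 * pi)" if t: "t \<in> lifted_arc a a"
    proof -
      obtain k :: int where "t = a + 2 * pi * of_int k" using t unfolding lifted_arc_def by force
      then show ?thesis unfolding lifted_arc_def by (intro CollectI exI[of _ "k - 1"]) (simp add: algebra_simps)
    qed
    moreover have "t \<in> lifted_arc (a + pi) (a + 2 * pi)" if "t \<in> lifted_arc (a + pi) (a + pi)"
      using that unfolding lifted_arc_def by force
    moreover have "t \<in> lifted_arc a (a + pi)" using t unfolding lifted_arc_def by force
    ultimately show "t \<in> lifted_arc a (a + pi) \<inter> lifted_arc (a + pi) (a + 2 * pi)" using t by auto
  qed
  show "lifted_arc a (a + pi) \<inter> lifted_arc (a + pi) (a + 2 * pi) \<subseteq> lifted_arc a a \<union> lifted_arc (a + pi) (a + pi)"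
  proof
    fix t assume "t \<in> lifted_arc a (a + pi) \<inter> lifted_arc (a + pi) (a + 2 * pi)"
    then obtain k j :: int where
      k: "a + 2 * pi * of_int k \<le> t" "t \<le> a + pi + 2 * pi * of_int k" and
      j: "a + pi + 2 * pi * of_int j \<le> t" "t \<le> a + 2 * pi + 2 * pi * of_int j"
      by (auto simp: lifted_arc_def)
    have "t = a + pi + 2 * pi * of_int k \<or> t = a + 2 * pi * of_int k"
      using turns_mono[of j k] turns_mono[of k j] k j pi_gt_zero
      by (cases j k rule: linorder_cases) auto
    then show "t \<in> lifted_arc a a \<union> lifted_arc (a + pi) (a + pi)" unfolding lifted_arc_def by force
  qed
qed

section \<open>Densities of Lipschitz functions\<close>

lemma small_scale_Lipschitz:
  fixes g :: "real \<Rightarrow> real"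
  assumes \<delta>: "0 < \<delta>"
    and small: "\<And>x y. p \<le> x \<Longrightarrow> x \<le> y \<Longrightarrow> y \<le> q \<Longrightarrow> y - x \<le> \<delta> \<Longrightarrow> \<bar>g y - g x\<bar> \<le> B * (y - x)"
    and xy: "p \<le> x" "x \<le> y" "y \<le> q"
  shows "\<bar>g y - g x\<bar> \<le> B * (y - x)"
proof -
  obtain n :: nat where "(y - x) / \<delta> \<le> real n" using real_arch_simple by blast
  then have "y - x \<le> real n * \<delta>" using \<delta> by (simp add: field_simps)
  then show ?thesis using xy
  proof (induction n arbitrary: x)
    case (Suc n)
    show ?case
    proof (cases "y - x \<le> \<delta>")
      case True
      then show ?thesis using small Suc.prems by simp
    next
      case False
      have "\<bar>g (x + \<delta>) - g x\<bar> \<le> B * \<delta>" using small[of x "x + \<delta>"] Suc.prems False \<delta> by simp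
      moreover have "\<bar>g y - g (x + \<delta>)\<bar> \<le> B * (y - (x + \<delta>))"
        using Suc.prems False \<delta> by (intro Suc.IH) (auto simp: algebra_simps)
      moreover have "B * (y - x) = B * \<delta> + B * (y - (x + \<delta>))" by (simp add: algebra_simps)
      ultimately show ?thesis by linarith
    qed
  qed simp
qed

text \<open>Adding a large multiple of the identity and freezing \<open>g\<close> outside \<open>[p, q]\<close> gives an increasing
bi-Lipschitz bijection \<open>F\<close> of the line. The image of Lebesgue measure under its inverse gives mass
\<open>F y - F x\<close> to \<open>[x, y)\<close>, and it is absolutely continuous because Lipschitz maps preserve null sets.
Radon-Nikodym provides the density, from which the slope of the added linear function is
subtracted again.\<close>

lemma Lipschitz_density:
  fixes g :: "real \<Rightarrow> real"
  assumes pq: "p \<le> q" and lip: "\<And>x y. p \<le> x \<Longrightarrow> x \<le> y \<Longrightarrow> y \<le> q \<Longrightarrow> \<bar>g y - g x\<bar> \<le> B * (y - x)"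
  shows "\<exists>\<kappa>\<in>borel_measurable borel. \<forall>x y. p \<le> x \<longrightarrow> x \<le> y \<longrightarrow> y \<le> q \<longrightarrow>
    has_bochner_integral lborel (\<lambda>s. indicator {x..<y} s * \<kappa> s) (g y - g x)"
proof -
  define c where "c x = max p (min q x)" for x
  define C where "C = \<bar>B\<bar> + 1"
  define F where "F x = g (c x) + C * x" for x
  have gc: "\<bar>g (c y) - g (c x)\<bar> \<le> \<bar>B\<bar> * (y - x)" if "x \<le> y" for x y
  proof -
    have c: "p \<le> c x" "c x \<le> c y" "c y \<le> q" "c y - c x \<le> y - x" using that pq by (auto simp: c_def)
    have "\<bar>g (c y) - g (c x)\<bar> \<le> B * (c y - c x)" using lip c by simp
    also have "\<dots> \<le> \<bar>B\<bar> * (c y - c x)" using c by (intro mult_right_mono) auto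
    also have "\<dots> \<le> \<bar>B\<bar> * (y - x)" using c by (intro mult_left_mono) auto
    finally show ?thesis .
  qed
  have F1: "y - x \<le> F y - F x" and F2: "F y - F x \<le> (\<bar>B\<bar> + C) * (y - x)" if "x \<le> y" for x y
    using gc[OF that] unfolding F_def C_def by (auto simp: algebra_simps)
  have C0: "0 < C" by (simp add: C_def)
  have F_less: "x \<le> y \<longleftrightarrow> F x \<le> F y" for x y
    using F1[of x y] F1[of y x] by (cases "x \<le> y") auto
  have F_lip: "\<bar>F y - F x\<bar> \<le> (\<bar>B\<bar> + C) * \<bar>y - x\<bar>" for x y
    using F1[of x y] F2[of x y] F1[of y x] F2[of y x] by (cases "x \<le> y") (auto simp: abs_if)
  have "(\<bar>B\<bar> + C)-lipschitz_on UNIV F"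
    using F_lip C0 by (intro lipschitz_onI) (auto simp: dist_real_def)
  then have contF: "continuous_on UNIV F" by (rule lipschitz_on_continuous_on)
  have "\<exists>x. F x = z" for z
  proof -
    have "F (- \<bar>z - F 0\<bar>) \<le> z" "z \<le> F \<bar>z - F 0\<bar>" using F1[of "- \<bar>z - F 0\<bar>" 0] F1[of 0 "\<bar>z - F 0\<bar>"] by auto
    then show ?thesis
      using IVT'[of F "- \<bar>z - F 0\<bar>" z "\<bar>z - F 0\<bar>"] continuous_on_subset[OF contF] by auto
  qed
  then have "surj F" by (metis surjI)
  moreover have "inj F" by (intro injI) (metis F_less order_antisym order_refl)
  ultimately have bij: "bij F" by (simp add: bij_def)
  define G where "G = inv F"
  have GF: "G (F x) = x" and FG: "F (G x) = x" for x
    unfolding G_def using bij by (simp_all add: bij_is_inj bij_is_surj surj_f_inv_f)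
  have "mono G" 
  proof (rule monoI)
    show "G x \<le> G y" if "x \<le> y" for x y using that F_less[of "G x" "G y"] unfolding FG by (rule iffD2[rotated])
  qed
  then have G[measurable]: "G \<in> borel_measurable borel" by (rule borel_measurable_mono)
  define \<mu> where "\<mu> = distr lborel borel G"
  have \<mu>: "emeasure \<mu> {x..<y} = ennreal (F y - F x)" if "x \<le> y" for x y
  proof -
    have le: "F w \<le> z \<longleftrightarrow> w \<le> G z" for w z
      using F_less[of w "G z"] by (simp only: FG)
    then have "z < F y \<longleftrightarrow> G z < y" for z by (metis not_le)
    with le have "G -` {x..<y} = {F x..<F y}" by auto
    moreover have "F x \<le> F y" using F_less that by blast
    ultimately show ?thesis unfolding \<mu>_def by (simp add: emeasure_distr)
  qed
  have ac: "absolutely_continuous lborel \<mu>"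
    unfolding absolutely_continuous_def
  proof
    fix N :: "real set" assume N: "N \<in> null_sets lborel"
    then have Nb[measurable]: "N \<in> sets borel" by auto
    have "negligible N" using N by (simp add: negligible_iff_null_sets null_sets_completion_iff)
    then have "negligible (F ` N)"
    proof (intro negligible_locally_Lipschitz_image)
      show "\<exists>T B. open T \<and> x \<in> T \<and> (\<forall>y\<in>N \<inter> T. norm (F y - F x) \<le> B * norm (y - x))" for x
        by (intro exI[of _ UNIV] exI[of _ "\<bar>B\<bar> + C"]) (use F_lip in auto)
    qed auto
    moreover have "F ` N = G -` N"
      using GF FG by (auto intro!: image_eqI[where x = "G _"])
    moreover have "G -` N \<in> sets borel" using measurable_sets[OF G Nb] by simp
    ultimately have "G -` N \<in> null_sets lborel"
      by (simp add: negligible_iff_null_sets null_sets_completion_iff)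
    then show "N \<in> null_sets \<mu>" unfolding \<mu>_def by (auto simp: null_sets_def emeasure_distr)
  qed
  obtain r where r[measurable]: "r \<in> borel_measurable borel" and dens: "density lborel r = \<mu>"
    using sigma_finite_measure.Radon_Nikodym[OF lborel.sigma_finite_measure_axioms ac] by (auto simp: \<mu>_def)
  have int: "(\<integral>\<^sup>+s. r s * indicator {x..<y} s \<partial>lborel) = ennreal (F y - F x)" if "x \<le> y" for x y
    using \<mu>[OF that] unfolding dens[symmetric] by (subst (asm) emeasure_density) auto
  have "AE s in lborel. r s * indicator {- real n..<real n} s \<noteq> \<infinity>" for n
    by (rule nn_integral_PInf_AE) (use int[of "- real n" "real n"] in auto)
  then have "AE s in lborel. \<forall>n. r s * indicator {- real n..<real n} s \<noteq> \<infinity>"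
    by (simp add: AE_all_countable)
  then have fin: "AE s in lborel. r s \<noteq> \<infinity>"
  proof eventually_elim
    case (elim s)
    obtain n :: nat where "\<bar>s\<bar> < real n" using reals_Archimedean2 by blast
    then have "s \<in> {- real n..<real n}" by auto
    then show ?case using elim[rule_format, of n] by simp
  qed
  define \<kappa> where "\<kappa> s = enn2real (r s) - C" for s
  have "\<kappa> \<in> borel_measurable borel" unfolding \<kappa>_def by measurable
  moreover have "has_bochner_integral lborel (\<lambda>s. indicator {x..<y} s * \<kappa> s) (g y - g x)"
    if xy: "p \<le> x" "x \<le> y" "y \<le> q" for x y
  proof -
    have "has_bochner_integral lborel (\<lambda>s. indicator {x..<y} s * enn2real (r s)) (F y - F x)"
    proof (rule has_bochner_integral_nn_integral)
      have "(\<integral>\<^sup>+s. ennreal (indicator {x..<y} s * enn2real (r s)) \<partial>lborel)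
          = (\<integral>\<^sup>+s. r s * indicator {x..<y} s \<partial>lborel)"
        using fin by (intro nn_integral_cong_AE) (auto split: split_indicator simp: less_top)
      then show "(\<integral>\<^sup>+s. ennreal (indicator {x..<y} s * enn2real (r s)) \<partial>lborel) = ennreal (F y - F x)"
        using int[OF xy(2)] by simp
    qed (use F1[OF xy(2)] xy in auto)
    moreover have "has_bochner_integral lborel (\<lambda>s. indicator {x..<y} s * C) (measure lborel {x..<y} * C)"
      by (intro has_bochner_integral_mult_left has_bochner_integral_real_indicator) (use xy in auto)
    ultimately have "has_bochner_integral lborel
        (\<lambda>s. indicator {x..<y} s * enn2real (r s) - indicator {x..<y} s * C)
        (F y - F x - measure lborel {x..<y} * C)"
      by (rule has_bochner_integral_diff)
    moreover have "F y - F x - measure lborel {x..<y} * C = g y - g x"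
      using xy by (simp add: F_def c_def algebra_simps)
    ultimately show ?thesis unfolding \<kappa>_def right_diff_distrib by simp
  qed
  ultimately show ?thesis by (intro bexI[of _ \<kappa>] allI impI)
qed

section \<open>Contributions of arcs to a valuation\<close>

text \<open>Under the condition \<open>2 * (M - c) \<le> l\<close>, which recurs below, the cones of slope \<open>l\<close> over functions in the band
reach the floor within distance \<open>1 / 2\<close> of their apex. So cones whose apices have distance at least \<open>1\<close>
do not meet above the floor.\<close>

definition band :: "real \<Rightarrow> real \<Rightarrow> real \<Rightarrow> (real \<Rightarrow> real) set" where
  "band c M l = {f. (\<forall>t. f (t + 2 * pi) = f t) \<and> l-lipschitz_on UNIV f \<and> (\<forall>t. c \<le> f t \<and> f t \<le> M)}"

lemma bandD:
  assumes "f \<in> band c M l"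
  shows "f (t + 2 * pi) = f t" "l-lipschitz_on UNIV f" "c \<le> f t" "f t \<le> M" "bdd_above (f ` E)" "0 \<le> l"
    "f \<in> periodic_Lip"
  using assms unfolding band_def periodic_Lip_def lipschitz_on_def by (auto simp: bdd_above_def)

lemma band_periodic_int: "f \<in> band c M l \<Longrightarrow> f (t + 2 * pi * of_int k) = f t"
  by (rule periodic_int) (rule bandD(1))

lemma const_in_periodic_Lip [simp]: "(\<lambda>_. c) \<in> periodic_Lip"
  unfolding periodic_Lip_def using lipschitz_on_constant by blast

lemma band_reflect:
  assumes "f \<in> band c M l" shows "(\<lambda>t. f (- t)) \<in> band c M l"
proof -
  have "dist (f (- x)) (f (- y)) \<le> l * dist x y" for x y
    using lipschitz_onD[OF bandD(2)[OF assms], of "- x" "- y"] by (simp add: dist_real_def abs_minus_commute)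
  then have "l-lipschitz_on UNIV (\<lambda>t. f (- t))"
    using bandD(6)[OF assms] by (intro lipschitz_onI) auto
  moreover have "f (- (t + 2 * pi)) = f (- t)" for t
    using bandD(1)[OF assms, of "- t - 2 * pi"] by simp
  ultimately show ?thesis using assms by (simp add: band_def)
qed

lemma band_cones_in_periodic_Lip:
  assumes "f \<in> band c M l" "\<And>t. t + 2 * pi \<in> E \<longleftrightarrow> t \<in> E"
  shows "cones c l E f \<in> periodic_Lip"
  using assms by (intro cones_in_periodic_Lip) (auto intro: bandD)

lemma band_cones_UNIV: "f \<in> band c M l \<Longrightarrow> cones c l UNIV f = f"
  by (rule cones_UNIV) (auto intro: bandD)

text \<open>The valuation on the circle, transported to \<open>2\<pi>\<close>-periodic functions on the line. The last assumption
is the consequence of \<open>\<tau>\<close>-continuity that the proof relies on; it is stated without derivatives: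
if \<open>F k\<close> and \<open>f\<close> differ by a constant near \<open>t\<close>, then they have the same derivative there.\<close>

locale circle_valuation =
  fixes W :: "(real \<Rightarrow> real) \<Rightarrow> real"
  assumes W_max_min: "f \<in> periodic_Lip \<Longrightarrow> g \<in> periodic_Lip \<Longrightarrow>
      W (\<lambda>t. max (f t) (g t)) + W (\<lambda>t. min (f t) (g t)) = W f + W g"
    and W_shift: "f \<in> periodic_Lip \<Longrightarrow> W (\<lambda>t. f (t + s)) = W f"
    and W_reflect: "f \<in> periodic_Lip \<Longrightarrow> W (\<lambda>t. f (- t)) = W f"
    and W_tendsto: "\<lbrakk>\<And>k. F k \<in> periodic_Lip; f \<in> periodic_Lip; \<And>k. L-lipschitz_on UNIV (F k);
      uniform_limit UNIV F f sequentially; finite N;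
      \<And>t. 0 < t \<Longrightarrow> t < 2 * pi \<Longrightarrow> t \<notin> N \<Longrightarrow>
        \<forall>\<^sub>F k in sequentially. \<exists>d. \<forall>\<^sub>F s in nhds t. F k s = f s + d\<rbrakk>
      \<Longrightarrow> (\<lambda>k. W (F k)) \<longlonglongrightarrow> W f"
begin

lemma W_cones_split:
  assumes f: "f \<in> band c M l"
    and E: "\<And>t. t + 2 * pi \<in> E \<longleftrightarrow> t \<in> E" and F: "\<And>t. t + 2 * pi \<in> F \<longleftrightarrow> t \<in> F"
    and sep: "\<And>e q. e \<in> E \<Longrightarrow> q \<in> F \<Longrightarrow>
      (\<exists>p\<in>E \<inter> F. e \<le> p \<and> p \<le> q \<or> q \<le> p \<and> p \<le> e) \<or> 2 * (M - c) \<le> l * \<bar>e - q\<bar>"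
  shows "W (cones c l (E \<union> F) f) + W (cones c l (E \<inter> F) f) = W (cones c l E f) + W (cones c l F f)"
proof -
  note b = bandD[OF f]
  have "f e + f q \<le> 2 * c + l * \<bar>e - q\<bar>" if "2 * (M - c) \<le> l * \<bar>e - q\<bar>" for e q
    using that b(4)[of e] b(4)[of q] by simp
  then have "cones c l (E \<inter> F) f = (\<lambda>t. min (cones c l E f t) (cones c l F f t))"
    using sep by (intro ext cones_Int b) blast+
  moreover have "cones c l (E \<union> F) f = (\<lambda>t. max (cones c l E f t) (cones c l F f t))"
    by (intro ext cones_Un b)
  ultimately show ?thesis
    using W_max_min[OF band_cones_in_periodic_Lip[OF f E] band_cones_in_periodic_Lip[OF f F]] by simp
qed

lemma W_cones_shift:
  assumes f: "f \<in> band c M l" and g: "g \<in> band c M l" and fg: "\<And>t. a \<le> t \<Longrightarrow> t \<le> b \<Longrightarrow> g (t + s) = f t"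
  shows "W (cones c l (lifted_arc (a + s) (b + s)) g) = W (cones c l (lifted_arc a b) f)"
proof -
  have "g (t + s) = f t" if t: "t \<in> lifted_arc a b" for t
  proof -
    obtain k :: int where k: "a + 2 * pi * of_int k \<le> t" "t \<le> b + 2 * pi * of_int k"
      using t unfolding lifted_arc_def by blast
    have "g (t - 2 * pi * of_int k + s) = f (t - 2 * pi * of_int k)" using k by (intro fg) auto
    then show ?thesis
      using band_periodic_int[OF f, of "t - 2 * pi * of_int k" k]
        band_periodic_int[OF g, of "t - 2 * pi * of_int k + s" k] by (simp add: algebra_simps)
  qed
  then have "cones c l (lifted_arc a b) (\<lambda>t. g (t + s)) = cones c l (lifted_arc a b) f"
    by (rule cones_cong)
  then have "cones c l (lifted_arc (a + s) (b + s)) g = (\<lambda>t. cones c l (lifted_arc a b) f (t + - s))"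
    by (simp add: lifted_arc_shift fun_eq_iff cones_shift)
  then show ?thesis
    using W_shift[OF band_cones_in_periodic_Lip[OF f lifted_arc_periodic], of a b "- s"] by simp
qed


lemma W_cones_reflect:
  assumes f: "f \<in> band c M l" and g: "g \<in> band c M l" and fg: "\<And>t. a \<le> t \<Longrightarrow> t \<le> b \<Longrightarrow> g (s - t) = f t"
  shows "W (cones c l (lifted_arc (s - b) (s - a)) g) = W (cones c l (lifted_arc a b) f)"
proof -
  have "W (cones c l (lifted_arc (s - b) (s - a)) g) = W (cones c l (lifted_arc (- b) (- a)) (\<lambda>t. f (- t)))"
    using fg[of "- _"] W_cones_shift[OF band_reflect[OF f] g, of "- b" "- a" s] by (simp add: algebra_simps)
  also have "cones c l (lifted_arc (- b) (- a)) (\<lambda>t. f (- t)) = (\<lambda>t. cones c l (lifted_arc a b) f (- t))"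
    by (simp add: lifted_arc_reflect fun_eq_iff cones_reflect)
  also have "W \<dots> = W (cones c l (lifted_arc a b) f)"
    by (rule W_reflect[OF band_cones_in_periodic_Lip[OF f lifted_arc_periodic]])
  finally show ?thesis .
qed

definition peak :: "real \<Rightarrow> real \<Rightarrow> real \<Rightarrow> real" where
  "peak c l u = W (cones c l (lifted_arc 0 0) (\<lambda>_. u)) - W (\<lambda>_. c)"

text \<open>The contribution of the arc from \<open>a\<close> to \<open>b\<close>, relative to the floor. The cones at an endpoint form
one half of a spike on the outer side of the arc, which is compensated by half the value of the
full spike.\<close>

definition ramp :: "real \<Rightarrow> real \<Rightarrow> (real \<Rightarrow> real) \<Rightarrow> real \<Rightarrow> real \<Rightarrow> real" where
  "ramp c l f a b = W (cones c l (lifted_arc a b) f) - W (\<lambda>_. c) - (peak c l (f a) + peak c l (f b)) / 2"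

lemma W_peak:
  assumes "f \<in> band c M l"
  shows "W (cones c l (lifted_arc a a) f) - W (\<lambda>_. c) = peak c l (f a)"
proof -
  have "(\<lambda>_. f a) \<in> band c M l"
    using bandD(3,4,6)[OF assms] by (auto simp: band_def intro: lipschitz_on_mono[OF lipschitz_on_constant])
  from W_cones_shift[OF this assms, of 0 0 a] show ?thesis by (simp add: peak_def)
qed

lemma ramp_shift:
  assumes "f \<in> band c M l" "g \<in> band c M l" "\<And>t. a \<le> t \<Longrightarrow> t \<le> b \<Longrightarrow> g (t + s) = f t" "a \<le> b"
  shows "ramp c l g (a + s) (b + s) = ramp c l f a b"
  unfolding ramp_def using W_cones_shift[OF assms(1-3)] assms(3)[of a] assms(3)[of b] assms(4) by simp

lemma ramp_reflect:
  assumes "f \<in> band c M l" "g \<in> band c M l" "\<And>t. a \<le> t \<Longrightarrow> t \<le> b \<Longrightarrow> g (s - t) = f t" "a \<le> b"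
  shows "ramp c l g (s - b) (s - a) = ramp c l f a b"
  unfolding ramp_def using W_cones_reflect[OF assms(1-3)] assms(3)[of a] assms(3)[of b] assms(4) by simp

lemma ramp_refl: "f \<in> band c M l \<Longrightarrow> ramp c l f a a = 0"
  using W_peak[of f c M l a] by (simp add: ramp_def)

text \<open>The bound on \<open>d - a\<close> leaves a gap of length \<open>1\<close> in the circle. In the gap the cones of the two
arcs do not meet above the floor, so the arcs interact at their common endpoint only.\<close>

lemma ramp_add:
  assumes f: "f \<in> band c M l" and room: "2 * (M - c) \<le> l" and ab: "a \<le> b" "b \<le> d" "d - a \<le> 2 * pi - 1"
  shows "ramp c l f a b + ramp c l f b d = ramp c l f a d"
proof -
  have l: "0 \<le> l" using bandD(6)[OF f] .
  have int: "lifted_arc a b \<inter> lifted_arc b d = lifted_arc b b" using ab by (intro lifted_arc_Int) auto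
  have sep: "(\<exists>p\<in>lifted_arc a b \<inter> lifted_arc b d. e \<le> p \<and> p \<le> q \<or> q \<le> p \<and> p \<le> e)
      \<or> 2 * (M - c) \<le> l * \<bar>e - q\<bar>"
    if e: "e \<in> lifted_arc a b" and q: "q \<in> lifted_arc b d" for e q
  proof -
    obtain k :: int where k: "a + 2 * pi * of_int k \<le> e" "e \<le> b + 2 * pi * of_int k"
      using e unfolding lifted_arc_def by blast
    obtain j :: int where j: "b + 2 * pi * of_int j \<le> q" "q \<le> d + 2 * pi * of_int j"
      using q unfolding lifted_arc_def by blast
    show ?thesis
    \<comment> \<open>The case distinction asks whether the way from \<open>e\<close> to \<open>q\<close> leads over \<open>b\<close> or over the gap.\<close>
    proof (cases "k \<le> j")
      case True
      have "b + 2 * pi * of_int k \<in> lifted_arc b b" unfolding lifted_arc_def by auto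
      moreover have "b + 2 * pi * of_int k \<le> q" using turns_mono'[OF True] j by linarith
      ultimately show ?thesis unfolding int using k by blast
    next
      case False
      then have "1 \<le> \<bar>e - q\<bar>" using turns_mono[of j k] k j ab by linarith
      then have "l \<le> l * \<bar>e - q\<bar>" using mult_left_mono[OF _ l, of 1] by simp
      then show ?thesis using room by simp
    qed
  qed
  show ?thesis
    using W_cones_split[OF f lifted_arc_periodic lifted_arc_periodic sep] W_peak[OF f, of b]
    unfolding lifted_arc_Un[OF ab(1,2)] int ramp_def by (simp add: field_simps)
qed

text \<open>The functions of two complementary half circles have \<open>f\<close> as their maximum, and as their minimum the
union of the spikes over the two common endpoints, which in turn are disjoint.\<close>

lemma ramp_close:
  assumes f: "f \<in> band c M l" and room: "2 * (M - c) \<le> l"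
  shows "ramp c l f a (a + pi) + ramp c l f (a + pi) (a + 2 * pi) = W f - W (\<lambda>_. c)"
proof -
  have l: "0 \<le> l" using bandD(6)[OF f] .
  let ?E = "lifted_arc a (a + pi)" and ?F = "lifted_arc (a + pi) (a + 2 * pi)"
  have sep: "(\<exists>p\<in>?E \<inter> ?F. e \<le> p \<and> p \<le> q \<or> q \<le> p \<and> p \<le> e) \<or> 2 * (M - c) \<le> l * \<bar>e - q\<bar>"
    if e: "e \<in> ?E" and q: "q \<in> ?F" for e q
  proof -
    obtain k :: int where k: "a + 2 * pi * of_int k \<le> e" "e \<le> a + pi + 2 * pi * of_int k"
      using e unfolding lifted_arc_def by blast
    obtain j :: int where j: "a + pi + 2 * pi * of_int j \<le> q" "q \<le> a + 2 * pi + 2 * pi * of_int j"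
      using q unfolding lifted_arc_def by blast
    have "a + pi + 2 * pi * of_int k \<in> lifted_arc (a + pi) (a + pi)" "a + 2 * pi * of_int k \<in> lifted_arc a a"
      unfolding lifted_arc_def by auto
    then have "a + pi + 2 * pi * of_int k \<in> ?E \<inter> ?F" "a + 2 * pi * of_int k \<in> ?E \<inter> ?F"
      unfolding lifted_arc_Int_opposite by blast+
    moreover have "a + pi + 2 * pi * of_int k \<le> q \<or> q \<le> a + 2 * pi * of_int k"
      using turns_cases[of k j] j by (elim disjE) linarith+
    ultimately show ?thesis using k by blast
  qed
  have sep': "(\<exists>p\<in>lifted_arc a a \<inter> lifted_arc (a + pi) (a + pi). e \<le> p \<and> p \<le> q \<or> q \<le> p \<and> p \<le> e)
      \<or> 2 * (M - c) \<le> l * \<bar>e - q\<bar>"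
    if e: "e \<in> lifted_arc a a" and q: "q \<in> lifted_arc (a + pi) (a + pi)" for e q
  proof -
    obtain k :: int where k: "a + 2 * pi * of_int k \<le> e" "e \<le> a + 2 * pi * of_int k"
      using e unfolding lifted_arc_def by blast
    obtain j :: int where j: "a + pi + 2 * pi * of_int j \<le> q" "q \<le> a + pi + 2 * pi * of_int j"
      using q unfolding lifted_arc_def by blast
    have "pi \<le> \<bar>e - q\<bar>"
      using turns_cases[of k j] j k pi_gt_zero by (elim disjE) linarith+
    then have "1 \<le> \<bar>e - q\<bar>" using pi_gt3 by linarith
    then have "l \<le> l * \<bar>e - q\<bar>" using mult_left_mono[OF _ l, of 1] by simp
    then show ?thesis using room by simp
  qed
  have disj: "lifted_arc a a \<inter> lifted_arc (a + pi) (a + pi) = {}"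
  proof -
    have False if t: "t \<in> lifted_arc a a" "t \<in> lifted_arc (a + pi) (a + pi)" for t
    proof -
      obtain k :: int where k: "t = a + 2 * pi * of_int k"
        using t(1) unfolding lifted_arc_def by force
      obtain j :: int where j: "t = a + pi + 2 * pi * of_int j"
        using t(2) unfolding lifted_arc_def by force
      show False
        using turns_cases[of k j] j k pi_gt_zero by (elim disjE) linarith+
    qed
    then show ?thesis by blast
  qed
  have 1: "W f + W (cones c l (lifted_arc a a \<union> lifted_arc (a + pi) (a + pi)) f) = W (cones c l ?E f) + W (cones c l ?F f)"
    using W_cones_split[OF f lifted_arc_periodic lifted_arc_periodic sep]
    unfolding lifted_arc_Int_opposite by (simp add: lifted_arc_Un lifted_arc_full band_cones_UNIV[OF f])
  have 2: "W (cones c l (lifted_arc a a \<union> lifted_arc (a + pi) (a + pi)) f) + W (\<lambda>_. c)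
      = W (cones c l (lifted_arc a a) f) + W (cones c l (lifted_arc (a + pi) (a + pi)) f)"
    using W_cones_split[OF f lifted_arc_periodic lifted_arc_periodic sep'] unfolding disj by simp
  have "f (a + 2 * pi) = f a" using bandD(1)[OF f] .
  then show ?thesis
    using 1 2 W_peak[OF f, of a] W_peak[OF f, of "a + pi"] unfolding ramp_def by (simp add: field_simps)
qed

end

section \<open>Linear pieces\<close>

lemma additive_imp_linear_on_interval:
  fixes r :: "real \<Rightarrow> real"
  assumes p: "0 < p"
    and add: "\<And>x y. 0 \<le> x \<Longrightarrow> 0 \<le> y \<Longrightarrow> x + y \<le> p \<Longrightarrow> r (x + y) = r x + r y"
    and cont: "\<And>X. X \<longlonglongrightarrow> 0 \<Longrightarrow> (\<And>n. 0 \<le> X n) \<Longrightarrow> (\<lambda>n. r (X n)) \<longlonglongrightarrow> 0"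
    and x: "0 \<le> x" "x \<le> p"
  shows "r x = x / p * r p"
proof -
  have r0: "r 0 = 0" using add[of 0 0] p by simp
  have mult: "r (real k * e) = real k * r e" if "0 \<le> e" "real k * e \<le> p" for k e
    using that
  proof (induction k)
    case (Suc k)
    have "real k * e \<le> p" using Suc.prems by (simp add: algebra_simps)
    then show ?case
      using Suc add[of "real k * e" e] by (simp add: algebra_simps)
  qed (simp add: r0)
  \<comment> \<open>Approximate \<open>x\<close> by multiples of \<open>p / Suc n\<close>.\<close>
  define k where "k n = nat \<lfloor>x / p * real (Suc n)\<rfloor>" for n
  define e where "e n = x - real (k n) * (p / Suc n)" for n
  have k: "real (k n) \<le> x / p * real (Suc n)" "x / p * real (Suc n) - 1 \<le> real (k n)" for n
  proof -
    have "0 \<le> x / p * real (Suc n)" using x p by simp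
    then show "real (k n) \<le> x / p * real (Suc n)" "x / p * real (Suc n) - 1 \<le> real (k n)"
      unfolding k_def by linarith+
  qed
  have e: "0 \<le> e n" "e n \<le> p / Suc n" for n
  proof -
    have "e n = p / Suc n * (x / p * real (Suc n) - real (k n))"
      using p unfolding e_def right_diff_distrib by simp
    moreover have "0 \<le> p / Suc n * (x / p * real (Suc n) - real (k n))"
      using k[of n] p by (intro mult_nonneg_nonneg) auto
    moreover have "p / Suc n * (x / p * real (Suc n) - real (k n)) \<le> p / Suc n * 1"
      using k[of n] p by (intro mult_left_mono) auto
    ultimately show "0 \<le> e n" "e n \<le> p / Suc n" by auto
  qed
  have eq: "r x = real (k n) / Suc n * r p + r (e n)" for n
  proof -
    have le: "real (k n) * (p / Suc n) \<le> p" using e(1)[of n] x(2) unfolding e_def by linarith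
    have "r x = r (real (k n) * (p / Suc n)) + r (e n)"
      using add[of "real (k n) * (p / Suc n)" "e n"] e(1)[of n] p x unfolding e_def by simp
    also have "r (real (k n) * (p / Suc n)) = real (k n) * r (p / Suc n)"
      using p le by (intro mult) auto
    also have "r (p / Suc n) = r p / Suc n"
    proof -
      have "real (Suc n) * (p / Suc n) = p" by simp
      then have "r p = real (Suc n) * r (p / Suc n)"
        using mult[of "p / Suc n" "Suc n"] p by simp
      then show ?thesis by (simp del: of_nat_Suc)
    qed
    finally show ?thesis by simp
  qed
  have e0: "e \<longlonglongrightarrow> 0"
  proof (rule tendsto_sandwich[of "\<lambda>_. 0" _ _ "\<lambda>n. p / Suc n"])
    show "(\<lambda>n. p / real (Suc n)) \<longlonglongrightarrow> 0"
      using tendsto_mult_right_zero[OF LIMSEQ_inverse_real_of_nat, of p] by (simp add: divide_inverse)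
  qed (use e in auto)
  have "(\<lambda>n. (x - e n) / p * r p + r (e n)) \<longlonglongrightarrow> (x - 0) / p * r p + 0"
    using e0 p e(1) by (intro tendsto_intros cont) auto
  moreover have "(x - e n) / p * r p + r (e n) = r x" for n
  proof -
    have "(x - e n) / p = real (k n) / Suc n" using p unfolding e_def by simp
    then show ?thesis using eq[of n] by simp
  qed
  ultimately have "(\<lambda>n. r x) \<longlonglongrightarrow> x / p * r p" by simp
  then show ?thesis by (simp add: LIMSEQ_const_iff)
qed

lemma cones_arc_const:
  assumes "0 \<le> x" "x \<le> s" "s \<le> 2 * pi" "0 \<le> l"
  shows "cones c l (lifted_arc 0 x) (\<lambda>_. u) s = max c (u - l * min (s - x) (2 * pi - s))"
proof -
  have b: "bdd_above ((\<lambda>_. u) ` lifted_arc 0 x)" by (auto simp: bdd_above_def)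
  have near: "min (s - x) (2 * pi - s) \<le> \<bar>s - q\<bar>" if q: "q \<in> lifted_arc 0 x" for q
  proof -
    obtain k :: int where k: "2 * pi * of_int k \<le> q" "q \<le> x + 2 * pi * of_int k"
      using q unfolding lifted_arc_def by auto
    show ?thesis
      using turns_cases[of k 0, unfolded of_int_0 mult_zero_right add_0] k assms by (elim disjE) linarith+
  qed
  have ends: "x \<in> lifted_arc 0 x" "2 * pi \<in> lifted_arc 0 x"
    unfolding lifted_arc_def using assms by (auto intro: exI[of _ 0] exI[of _ 1])
  show ?thesis
  proof (rule antisym)
    have "u - l * \<bar>s - q\<bar> \<le> max c (u - l * min (s - x) (2 * pi - s))" if "q \<in> lifted_arc 0 x" for q
      using mult_left_mono[OF near[OF that] assms(4)] by linarith
    then show "cones c l (lifted_arc 0 x) (\<lambda>_. u) s \<le> max c (u - l * min (s - x) (2 * pi - s))"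
      unfolding cones_le_iff[OF b assms(4)] by (intro conjI ballI max.cobounded1)
    have "u - l * min (s - x) (2 * pi - s) \<le> cones c l (lifted_arc 0 x) (\<lambda>_. u) s"
      using cones_ge(2)[OF b assms(4) ends(1), of s c] cones_ge(2)[OF b assms(4) ends(2), of s c] assms
      by (auto simp: min_def)
    then show "max c (u - l * min (s - x) (2 * pi - s)) \<le> cones c l (lifted_arc 0 x) (\<lambda>_. u) s"
      using cones_ge(1)[OF b assms(4), of c s] by simp
  qed
qed

lemma cones_arc_const_close:
  assumes "0 \<le> x" "0 \<le> l"
  shows "\<bar>cones c l (lifted_arc 0 x) (\<lambda>_. u) t - cones c l (lifted_arc 0 0) (\<lambda>_. u) t\<bar> \<le> l * x"
proof -
  have b: "bdd_above ((\<lambda>_. u) ` lifted_arc 0 y)" for y by (auto simp: bdd_above_def)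
  have "lifted_arc 0 0 \<subseteq> lifted_arc 0 x" using assms unfolding lifted_arc_def by force
  then have "cones c l (lifted_arc 0 0) (\<lambda>_. u) t \<le> cones c l (lifted_arc 0 x) (\<lambda>_. u) t"
    using cones_ge(1)[OF b assms(2)] cones_ge(2)[OF b assms(2), of _ x]
    unfolding cones_le_iff[OF b assms(2)] by blast
  moreover have "cones c l (lifted_arc 0 x) (\<lambda>_. u) t \<le> cones c l (lifted_arc 0 0) (\<lambda>_. u) t + l * x"
    unfolding cones_le_iff[OF b assms(2)]
  proof (intro conjI ballI)
    show "c \<le> cones c l (lifted_arc 0 0) (\<lambda>_. u) t + l * x"
      using cones_ge(1)[OF b assms(2), of c 0 t] assms by (simp add: add_increasing2)
    fix s assume s: "s \<in> lifted_arc 0 x"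
    obtain k :: int where k: "2 * pi * of_int k \<le> s" "s \<le> x + 2 * pi * of_int k"
      using s unfolding lifted_arc_def by auto
    have m: "2 * pi * of_int k \<in> lifted_arc 0 0" unfolding lifted_arc_def by auto
    have "l * \<bar>t - 2 * pi * of_int k\<bar> \<le> l * (\<bar>t - s\<bar> + x)"
      using k by (intro mult_left_mono assms(2)) linarith
    then show "u - l * \<bar>t - s\<bar> \<le> cones c l (lifted_arc 0 0) (\<lambda>_. u) t + l * x"
      using cones_ge(2)[OF b assms(2) m, of t c] by (simp add: algebra_simps)
  qed
  ultimately show ?thesis by linarith
qed

lemma const_in_band: "c \<le> u \<Longrightarrow> u \<le> M \<Longrightarrow> 0 \<le> l \<Longrightarrow> (\<lambda>_. u) \<in> band c M l"
  by (auto simp: band_def intro: lipschitz_on_mono[OF lipschitz_on_constant])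

context circle_valuation begin

text \<open>As the arc shrinks to a point, the plateaus converge to the spike: away from the peak
and the two points at which the spike meets the floor, the function of a short arc differs from the spike
locally by a constant.\<close>

lemma W_cones_arc_const_tendsto:
  assumes cu: "c < u" "0 < l" and room: "2 * (u - c) \<le> l"
    and X: "X \<longlonglongrightarrow> 0" "\<And>n. 0 \<le> X n"
  shows "(\<lambda>n. W (cones c l (lifted_arc 0 (X n)) (\<lambda>_. u))) \<longlonglongrightarrow> W (cones c l (lifted_arc 0 0) (\<lambda>_. u))"
proof (rule W_tendsto[where L = l and N = "{(u - c) / l, 2 * pi - (u - c) / l}"])
  let ?g = "\<lambda>x. cones c l (lifted_arc 0 x) (\<lambda>_. u)"
  have band: "(\<lambda>_. u) \<in> band c u l" using cu by (intro const_in_band) auto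
  show "?g x \<in> periodic_Lip" "?g x \<in> periodic_Lip" for x
    by (rule band_cones_in_periodic_Lip[OF band lifted_arc_periodic])+
  show "l-lipschitz_on UNIV (?g (X k))" for k
    by (rule cones_lipschitz) (use cu in \<open>auto simp: bdd_above_def\<close>)
  show "uniform_limit UNIV (\<lambda>k. ?g (X k)) (?g 0) sequentially"
  proof (rule uniform_limitI)
    fix e :: real assume "0 < e"
    have "(\<lambda>n. l * X n) \<longlonglongrightarrow> l * 0" by (intro tendsto_intros X)
    then have "\<forall>\<^sub>F n in sequentially. l * X n < e" using \<open>0 < e\<close> by (intro order_tendstoD) auto
    then show "\<forall>\<^sub>F n in sequentially. \<forall>t\<in>UNIV. dist (?g (X n) t) (?g 0 t) < e"
    proof eventually_elim
      case (elim n)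
      then show ?case
        using cones_arc_const_close[of "X n" l c u] X(2)[of n] cu by (auto simp: dist_real_def intro: le_less_trans)
    qed
  qed
  fix t assume t: "0 < t" "t < 2 * pi" "t \<notin> {(u - c) / l, 2 * pi - (u - c) / l}"
  define h where "h = (u - c) / l"
  have h: "0 < h" "h \<le> 1 / 2" "l * h = u - c" using cu room by (simp_all add: h_def field_simps)
  \<comment> \<open>A radius such that for \<open>X n < w\<close> the neighbourhood of \<open>t\<close> stays within one linear piece.\<close>
  define w where "w = Min {t, 2 * pi - t, \<bar>t - h\<bar>, \<bar>t - (2 * pi - h)\<bar>} / 3"
  have w: "0 < w" "3 * w \<le> t" "3 * w \<le> 2 * pi - t" "3 * w \<le> \<bar>t - h\<bar>" "3 * w \<le> \<bar>t - (2 * pi - h)\<bar>"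
    using t unfolding w_def h_def by (auto simp: min_def)
  have "\<forall>\<^sub>F n in sequentially. X n < w" using X(1) w(1) by (rule order_tendstoD)
  then show "\<forall>\<^sub>F n in sequentially. \<exists>d. \<forall>\<^sub>F s in nhds t. ?g (X n) s = ?g 0 s + d"
  proof eventually_elim
    case (elim n)
    have form: "?g x s = max c (u - l * min (s - x) (2 * pi - s))" if "\<bar>s - t\<bar> < w" "0 \<le> x" "x < w" for s x
      using that w cu by (intro cones_arc_const) auto
    have low: "u - l * y \<le> c" if "h \<le> y" for y
      using mult_left_mono[OF that, of l] h cu by simp
    have high: "c \<le> u - l * y" if "y \<le> h" for y
      using mult_left_mono[OF that, of l] h cu by simp
    have "\<exists>d. \<forall>s. \<bar>s - t\<bar> < w \<longrightarrow> ?g (X n) s = ?g 0 s + d"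
    proof -
      consider "t < h" | "h < t" "t < 2 * pi - h" | "2 * pi - h < t" using t unfolding h_def by force
      then show ?thesis
      proof cases
        case 1
        have "?g x s = u - l * (s - x)" if "\<bar>s - t\<bar> < w" "0 \<le> x" "x < w" for s x
        proof -
          have "min (s - x) (2 * pi - s) = s - x"
            using that 1 w h pi_gt3 by (intro min_absorb1) linarith
          then show ?thesis using form[OF that] high[of "s - x"] that 1 w by simp
        qed
        from this[of _ "X n"] this[of _ 0] show ?thesis
          using elim w X(2)[of n] by (intro exI[of _ "l * X n"]) (simp add: right_diff_distrib)
      next
        case 2
        have "?g x s = c" if "\<bar>s - t\<bar> < w" "0 \<le> x" "x < w" for s x
        proof -
          have "h \<le> s - x" "h \<le> 2 * pi - s" using that 2 w by linarith+
          then have "h \<le> min (s - x) (2 * pi - s)" by simp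
          then show ?thesis using form[OF that] low by (simp add: max_absorb1)
        qed
        then show ?thesis using elim w X(2)[of n] by (intro exI[of _ 0]) auto
      next
        case 3
        have "?g x s = u - l * (2 * pi - s)" if "\<bar>s - t\<bar> < w" "0 \<le> x" "x < w" for s x
        proof -
          have "min (s - x) (2 * pi - s) = 2 * pi - s"
            using that 3 w h pi_gt3 by (intro min_absorb2) linarith
          then show ?thesis using form[OF that] high[of "2 * pi - s"] that 3 w by simp
        qed
        then show ?thesis using elim w X(2)[of n] by (intro exI[of _ 0]) auto
      qed
    qed
    then obtain d where d: "\<And>s. \<bar>s - t\<bar> < w \<Longrightarrow> ?g (X n) s = ?g 0 s + d" by blast
    have "\<forall>\<^sub>F s in nhds t. \<bar>s - t\<bar> < w"
      using eventually_nhds_ball[OF w(1), of t] by (simp add: dist_real_def abs_minus_commute)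
    then show ?case using d by (auto elim: eventually_mono intro!: exI[of _ d])
  qed
qed auto

text \<open>The contribution of a constant piece is additive in its length and continuous at \<open>0\<close>, hence linear;
the factor follows from the constant function on the whole circle.\<close>

lemma ramp_const:
  assumes cu: "c \<le> u" "u \<le> M" and room: "2 * (M - c) \<le> l" and L: "0 \<le> L" "L \<le> pi"
  shows "ramp c l (\<lambda>_. u) 0 L = L / (2 * pi) * (W (\<lambda>_. u) - W (\<lambda>_. c))"
proof (cases "c = u")
  case True
  have "cones c l E (\<lambda>_. c) = (\<lambda>_. c)" for E
  proof
    fix t
    have b: "bdd_above ((\<lambda>_. c) ` E)" "0 \<le> l" using assms by (auto simp: bdd_above_def)
    show "cones c l E (\<lambda>_. c) t = c"
      using b(2) by (intro antisym cones_ge(1)[OF b]) (auto simp: cones_le_iff[OF b])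
  qed
  then show ?thesis using True by (simp add: ramp_def peak_def)
next
  case False
  have l: "0 < l" using False assms by simp
  have f: "(\<lambda>_. u) \<in> band c M l" using assms l by (intro const_in_band) auto
  let ?r = "ramp c l (\<lambda>_. u) 0"
  have lin: "?r x = x / pi * ?r pi" if "0 \<le> x" "x \<le> pi" for x
    using pi_gt_zero
  proof (rule additive_imp_linear_on_interval)
    show "?r (x + y) = ?r x + ?r y" if "0 \<le> x" "0 \<le> y" "x + y \<le> pi" for x y
      using ramp_add[OF f room, of 0 x "x + y"] ramp_shift[OF f f, of 0 y x] that pi_gt3
      by (simp add: add.commute)
    show "(\<lambda>n. ?r (X n)) \<longlonglongrightarrow> 0" if "X \<longlonglongrightarrow> 0" "\<And>n. 0 \<le> X n" for X
    proof -
      have "(\<lambda>n. ?r (X n)) \<longlonglongrightarrow> ?r 0"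
        unfolding ramp_def using False assms l that
        by (intro tendsto_intros W_cones_arc_const_tendsto) auto
      then show ?thesis using ramp_refl[OF f] by simp
    qed
  qed (use that in auto)
  have "?r pi + ?r pi = W (\<lambda>_. u) - W (\<lambda>_. c)"
    using ramp_close[OF f room, of 0] ramp_shift[OF f f, of 0 pi pi] by simp
  then have half: "?r pi = (W (\<lambda>_. u) - W (\<lambda>_. c)) / 2" by simp
  show ?thesis unfolding lin[OF L] half by simp
qed


definition spike :: "real \<Rightarrow> real \<Rightarrow> real \<Rightarrow> real \<Rightarrow> real" where
  "spike u \<gamma> v = cones u \<gamma> (lifted_arc 0 0) (\<lambda>_. v)"

lemma spike_eq:
  assumes "0 \<le> s" "s \<le> 2 * pi" "0 \<le> \<gamma>"
  shows "spike u \<gamma> v s = max u (v - \<gamma> * min s (2 * pi - s))"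
  unfolding spike_def using cones_arc_const[of 0 s \<gamma> u v] assms by simp

lemma spike_in_band:
  assumes "c \<le> u" "u \<le> v" "v \<le> M" "0 \<le> \<gamma>" "\<gamma> \<le> l"
  shows "spike u \<gamma> v \<in> band c M l"
proof -
  have b: "bdd_above ((\<lambda>_. v) ` lifted_arc 0 0)" by (auto simp: bdd_above_def)
  have "spike u \<gamma> v t \<le> M" for t
  proof -
    have "v - \<gamma> * \<bar>t - s\<bar> \<le> M" for s
      using assms mult_nonneg_nonneg[OF assms(4), of "\<bar>t - s\<bar>"] by linarith
    then show ?thesis
      unfolding spike_def cones_le_iff[OF b assms(4)] using assms by (auto intro: order_trans)
  qed
  moreover have "c \<le> spike u \<gamma> v t" for t
    using cones_ge(1)[OF b assms(4), of u t] assms by (simp add: spike_def)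
  moreover have "l-lipschitz_on UNIV (spike u \<gamma> v)"
    unfolding spike_def using assms by (intro lipschitz_on_mono[OF cones_lipschitz[OF b]]) auto
  moreover have "spike u \<gamma> v (t + 2 * pi) = spike u \<gamma> v t" for t
    unfolding spike_def by (intro cones_periodic lifted_arc_periodic) simp
  ultimately show ?thesis by (simp add: band_def)
qed

text \<open>What a piece of slope \<open>\<gamma>\<close> between the heights \<open>u\<close> and \<open>v\<close> contributes. The function \<open>spike u \<gamma> v\<close>
consists of two such pieces and of a constant piece at height \<open>u\<close>, which fills the fraction
\<open>1 - (v - u) / (pi * \<gamma>)\<close> of the circle.\<close>

definition climb :: "real \<Rightarrow> real \<Rightarrow> real \<Rightarrow> real" where
  "climb \<gamma> u v = (W (spike u \<gamma> v) - (1 - (v - u) / (pi * \<gamma>)) * W (\<lambda>_. u)) / 2"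

text \<open>The spike contains a copy of the descending piece. So its value is a combination, by symmetry, of the
contribution of the piece and that of a constant remainder, and the equation can be solved for the
former. The share of the floor depends on the length of the piece alone.\<close>

lemma ramp_descending:
  assumes f: "f \<in> band c M l" and room: "2 * (M - c) \<le> l" and ab: "a \<le> b" "b \<le> a + pi"
    and \<gamma>: "0 < \<gamma>" "\<gamma> \<le> l" and aff: "\<And>t. a \<le> t \<Longrightarrow> t \<le> b \<Longrightarrow> f t = f a - \<gamma> * (t - a)"
  shows "ramp c l f a b + (b - a) / (2 * pi) * W (\<lambda>_. c) = climb \<gamma> (f b) (f a)"
proof -
  define L u v S where "L = b - a" "u = f b" "v = f a" "S = spike (f b) \<gamma> (f a)"
  note defs = L_u_v_S_def
  have fb: "f b = f a - \<gamma> * (b - a)" using aff[of b] ab by simp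
  have L: "0 \<le> L" "L \<le> pi" "v = u + \<gamma> * L" using ab fb by (simp_all add: defs)
  have bnds: "c \<le> u" "u \<le> v" "v \<le> M"
  proof -
    have "0 \<le> \<gamma> * L" using L \<gamma> by simp
    then show "c \<le> u" "u \<le> v" "v \<le> M"
      using bandD(3)[OF f, of b] bandD(4)[OF f, of a] L(3) unfolding defs(2,3) by linarith+
  qed
  have S: "S \<in> band c M l" unfolding defs using bnds \<gamma> by (intro spike_in_band) (auto simp: defs)
  have uc: "(\<lambda>_. u) \<in> band c M l" using bnds \<gamma> by (intro const_in_band) auto
  have S1: "S t = v - \<gamma> * t" if "0 \<le> t" "t \<le> L" for t
  proof -
    have "\<gamma> * t \<le> \<gamma> * L" using that \<gamma> by (intro mult_left_mono) auto
    moreover have "min t (2 * pi - t) = t" using that L by simp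
    ultimately show ?thesis using spike_eq[of t \<gamma> u v] that L \<gamma> pi_gt_zero by (simp add: defs)
  qed
  have S2: "S t = u" if "L \<le> t" "t \<le> pi" for t
  proof -
    have "\<gamma> * L \<le> \<gamma> * t" using that \<gamma> by (intro mult_left_mono) auto
    moreover have "min t (2 * pi - t) = t" using that L by simp
    ultimately show ?thesis using spike_eq[of t \<gamma> u v] that L \<gamma> pi_gt_zero by (simp add: defs)
  qed
  have S3: "S (2 * pi - t) = S t" if "0 \<le> t" "t \<le> pi" for t
    using spike_eq[of t \<gamma> u v] spike_eq[of "2 * pi - t" \<gamma> u v] that \<gamma> by (simp add: defs min.commute)
  have "ramp c l f (0 + a) (L + a) = ramp c l S 0 L"
  proof (rule ramp_shift[OF S f])
    show "f (t + a) = S t" if "0 \<le> t" "t \<le> L" for t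
      using aff[of "t + a"] S1[OF that] that by (simp add: defs(1,3))
  qed (use L in auto)
  moreover have "ramp c l S 0 L + ramp c l S L pi = ramp c l S 0 pi"
    using L pi_gt3 by (intro ramp_add[OF S room]) auto
  moreover have "ramp c l S (0 + L) (pi - L + L) = ramp c l (\<lambda>_. u) 0 (pi - L)"
    using L by (intro ramp_shift[OF uc S]) (auto simp: S2)
  moreover have "2 * ramp c l (\<lambda>_. u) 0 (pi - L) = (1 - L / pi) * (W (\<lambda>_. u) - W (\<lambda>_. c))"
  proof -
    have "ramp c l (\<lambda>_. u) 0 (pi - L) = (pi - L) / (2 * pi) * (W (\<lambda>_. u) - W (\<lambda>_. c))"
      using bnds L by (intro ramp_const[OF _ _ room]) auto
    moreover have "(pi - L) / (2 * pi) = (1 - L / pi) / 2" by (simp add: field_simps)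
    ultimately show ?thesis by simp
  qed
  moreover have "ramp c l S (2 * pi - pi) (2 * pi - 0) = ramp c l S 0 pi"
    by (intro ramp_reflect[OF S S]) (auto simp: S3)
  moreover have "ramp c l S 0 pi + ramp c l S pi (2 * pi) = W S - W (\<lambda>_. c)"
    using ramp_close[OF S room, of 0] by simp
  ultimately have "2 * ramp c l f a b = W S - W (\<lambda>_. c) - (1 - L / pi) * (W (\<lambda>_. u) - W (\<lambda>_. c))"
    by (simp add: defs(1))
  moreover have "(v - u) / (pi * \<gamma>) = L / pi" using L(3) \<gamma> by simp
  moreover have "S = spike u \<gamma> v" by (simp add: defs)
  moreover have "(b - a) / (2 * pi) = L / pi / 2" by (simp add: defs)
  ultimately show ?thesis unfolding climb_def defs(2-4)[symmetric] by (simp add: algebra_simps)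
qed

lemma ramp_ascending:
  assumes f: "f \<in> band c M l" and room: "2 * (M - c) \<le> l" and ab: "a \<le> b" "b \<le> a + pi"
    and \<gamma>: "0 < \<gamma>" "\<gamma> \<le> l" and aff: "\<And>t. a \<le> t \<Longrightarrow> t \<le> b \<Longrightarrow> f t = f a + \<gamma> * (t - a)"
  shows "ramp c l f a b + (b - a) / (2 * pi) * W (\<lambda>_. c) = climb \<gamma> (f a) (f b)"
proof -
  have "ramp c l (\<lambda>t. f (- t)) (0 - b) (0 - a) = ramp c l f a b"
    by (rule ramp_reflect[OF f band_reflect[OF f]]) (use ab in auto)
  moreover have "ramp c l (\<lambda>t. f (- t)) (- b) (- a) + (- a - (- b)) / (2 * pi) * W (\<lambda>_. c)
      = climb \<gamma> (f (- (- a))) (f (- (- b)))"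
  proof (rule ramp_descending[OF band_reflect[OF f] room])
    show "f (- t) = f (- (- b)) - \<gamma> * (t - (- b))" if "- b \<le> t" "t \<le> - a" for t
      using aff[of "- t"] aff[of b] that ab by (simp add: algebra_simps)
  qed (use ab \<gamma> in auto)
  ultimately show ?thesis by simp
qed

text \<open>Up to shares of the floor, both sides are contributions of arcs of the descending flank of a single
spike, taken with respect to a floor and a slope for which that spike lies in the band.\<close>

lemma climb_add:
  assumes \<gamma>: "0 < \<gamma>" and uwv: "u \<le> w" "w \<le> v" "v - u \<le> pi * \<gamma>"
  shows "climb \<gamma> u w + climb \<gamma> w v = climb \<gamma> u v"
proof -
  define l where "l = max \<gamma> (2 * (v - u))"
  define S where "S = spike u \<gamma> v"
  have room: "2 * (v - u) \<le> l" "\<gamma> \<le> l" by (auto simp: l_def)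
  have S: "S \<in> band u v l" unfolding S_def using assms room by (intro spike_in_band) auto
  define x y where "x = (v - w) / \<gamma>" "y = (v - u) / \<gamma>"
  note defs = x_y_def
  have xy: "0 \<le> x" "x \<le> y" "y \<le> pi" using assms by (auto simp: defs divide_right_mono field_simps)
  have St: "S t = v - \<gamma> * t" if "0 \<le> t" "t \<le> y" for t
  proof -
    have "\<gamma> * t \<le> \<gamma> * y" using that \<gamma> by (intro mult_left_mono) auto
    moreover have "min t (2 * pi - t) = t" using that xy by simp
    moreover have "\<gamma> * y = v - u" using \<gamma> by (simp add: defs)
    ultimately show ?thesis using spike_eq[of t \<gamma> u v] that xy \<gamma> pi_gt_zero by (simp add: S_def)
  qed
  have vals: "S 0 = v" "S x = w" "S y = u" using St[of 0] St[of x] St[of y] xy \<gamma> by (auto simp: defs)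
  have desc: "ramp u l S a b + (b - a) / (2 * pi) * W (\<lambda>_. u) = climb \<gamma> (S b) (S a)"
    if "0 \<le> a" "a \<le> b" "b \<le> y" for a b
    using that xy by (intro ramp_descending[OF S room(1) _ _ \<gamma> room(2)]) (auto simp: St algebra_simps)
  have "ramp u l S 0 x + ramp u l S x y = ramp u l S 0 y"
    using xy pi_gt3 by (intro ramp_add[OF S room(1)]) auto
  moreover have "(x - 0) / (2 * pi) * W (\<lambda>_. u) + (y - x) / (2 * pi) * W (\<lambda>_. u)
      = (y - 0) / (2 * pi) * W (\<lambda>_. u)"
    by (simp add: field_simps)
  ultimately show ?thesis
    using desc[of 0 x] desc[of x y] desc[of 0 y] xy unfolding vals by linarith
qed

lemma climb_refl: "0 \<le> \<gamma> \<Longrightarrow> climb \<gamma> u u = 0"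
proof -
  assume \<gamma>: "0 \<le> \<gamma>"
  have S: "spike u \<gamma> u \<in> band u u \<gamma>" using \<gamma> by (intro spike_in_band) auto
  have "spike u \<gamma> u t = u" for t using bandD(3,4)[OF S, of t] by simp
  then have "spike u \<gamma> u = (\<lambda>_. u)" by auto
  then show ?thesis by (simp add: climb_def)
qed

end

section \<open>Repeated spikes and the Lipschitz bound\<close>

definition comb :: "real \<Rightarrow> nat \<Rightarrow> real set" where
  "comb p m = (\<Union>j<m. lifted_arc (real j * p) (real j * p))"

lemma comb_periodic: "t + 2 * pi \<in> comb p m \<longleftrightarrow> t \<in> comb p m"
  by (simp add: comb_def lifted_arc_periodic)

lemma comb_subset_arc: "0 \<le> p \<Longrightarrow> comb p m \<subseteq> lifted_arc 0 (real m * p)"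
proof
  fix t assume p: "0 \<le> p" and "t \<in> comb p m"
  then obtain j and k :: int where j: "j < m" "t = real j * p + 2 * pi * of_int k"
    unfolding comb_def lifted_arc_def by force
  have "0 \<le> real j * p" "real j * p \<le> real m * p" using j p by (auto intro: mult_right_mono)
  then show "t \<in> lifted_arc 0 (real m * p)" unfolding lifted_arc_def using j by (auto intro!: exI[of _ k])
qed

context circle_valuation begin

text \<open>The spikes of width \<open>2 * (v - u) / \<gamma>\<close> over the points of the comb are disjoint as long as they fit
into the circle.\<close>

lemma W_comb:
  assumes \<gamma>: "0 < \<gamma>" and uv: "u \<le> v" and len: "real m * (2 * (v - u) / \<gamma>) \<le> 2 * pi"
  shows "W (cones u \<gamma> (comb (2 * (v - u) / \<gamma>) m) (\<lambda>_. v)) = W (\<lambda>_. u) + real m * (W (spike u \<gamma> v) - W (\<lambda>_. u))"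
  using len
proof (induction m)
  case 0
  then show ?case by (simp add: comb_def)
next
  case (Suc m)
  define p where "p = 2 * (v - u) / \<gamma>"
  have p: "0 \<le> p" "\<gamma> * p = 2 * (v - u)" using \<gamma> uv by (auto simp: p_def)
  have len: "real m * p + p \<le> 2 * pi" using Suc.prems unfolding p_def[symmetric] by (simp add: algebra_simps)
  have vb: "(\<lambda>_. v) \<in> band u v \<gamma>" using \<gamma> uv by (intro const_in_band) auto
  let ?q = "real m * p"
  have gap: "2 * (v - u) \<le> \<gamma> * \<bar>e - q\<bar>" if e: "e \<in> comb p m" and q: "q \<in> lifted_arc ?q ?q" for e q
  proof -
    obtain j and k :: int where j: "j < m" "e = real j * p + 2 * pi * of_int k"
      using e unfolding comb_def lifted_arc_def by force
    obtain i :: int where i: "q = real m * p + 2 * pi * of_int i"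
      using q unfolding lifted_arc_def by force
    have "real (Suc j) * p \<le> real m * p" using j p by (intro mult_right_mono) auto
    then have jm: "real j * p + p \<le> real m * p" by (simp add: algebra_simps)
    have j0: "0 \<le> real j * p" using p by simp
    have "p \<le> \<bar>e - q\<bar>"
      using turns_cases[of k i] jm j0 j i len by (elim disjE) linarith+
    then show ?thesis using mult_left_mono[of p "\<bar>e - q\<bar>" \<gamma>] \<gamma> p by simp
  qed
  have disj: "cones u \<gamma> (comb p m \<inter> lifted_arc ?q ?q) (\<lambda>_. v) = (\<lambda>_. u)"
  proof (cases "p = 0")
    case True
    then have "u = v" using p by simp
    show ?thesis
    proof
      fix t
      have b: "bdd_above ((\<lambda>_. v) ` (comb p m \<inter> lifted_arc ?q ?q))" by (auto simp: bdd_above_def)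
      show "cones u \<gamma> (comb p m \<inter> lifted_arc ?q ?q) (\<lambda>_. v) t = u"
        using \<gamma> \<open>u = v\<close> b by (intro antisym cones_ge(1)) (auto simp: cones_le_iff)
    qed
  next
    case False
    then have "0 < v - u" using p mult_pos_pos[OF \<gamma>, of p] by simp
    then have "comb p m \<inter> lifted_arc ?q ?q = {}"
      using gap[of x x for x] by (intro equals0I) fastforce
    then show ?thesis by simp
  qed
  have "W (cones u \<gamma> (comb p m \<union> lifted_arc ?q ?q) (\<lambda>_. v)) + W (cones u \<gamma> (comb p m \<inter> lifted_arc ?q ?q) (\<lambda>_. v))
      = W (cones u \<gamma> (comb p m) (\<lambda>_. v)) + W (cones u \<gamma> (lifted_arc ?q ?q) (\<lambda>_. v))"
    by (rule W_cones_split[OF vb comb_periodic lifted_arc_periodic]) (use gap in blast)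
  moreover have "comb p (Suc m) = comb p m \<union> lifted_arc ?q ?q"
    by (auto simp: comb_def lessThan_Suc)
  moreover have "W (cones u \<gamma> (lifted_arc ?q ?q) (\<lambda>_. v)) = W (spike u \<gamma> v)"
    using W_cones_shift[OF vb vb, of 0 0 ?q] by (simp add: spike_def)
  moreover have "W (cones u \<gamma> (comb p m) (\<lambda>_. v)) = W (\<lambda>_. u) + real m * (W (spike u \<gamma> v) - W (\<lambda>_. u))"
    using Suc.IH len p unfolding p_def[symmetric] by simp
  ultimately show ?case unfolding p_def[symmetric] disj by (simp add: algebra_simps)
qed

lemma W_const_tendsto:
  assumes "X \<longlonglongrightarrow> u" shows "(\<lambda>n. W (\<lambda>_. X n)) \<longlonglongrightarrow> W (\<lambda>_. u)"
proof (rule W_tendsto[where L = 0 and N = "{}"])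
  show "uniform_limit UNIV (\<lambda>k _. X k) (\<lambda>_. u) sequentially"
    using assms by (intro uniform_limitI) (auto dest: tendstoD)
  show "\<forall>\<^sub>F k in sequentially. \<exists>d. \<forall>\<^sub>F s in nhds t. X k = u + d" for t :: real
    by (intro always_eventually allI exI[of _ "X _ - u"]) simp
qed (auto intro: lipschitz_on_constant)

text \<open>The combs occupy a set of measure \<open>2 * m k * (v k - u k) / \<gamma>\<close>, which tends to \<open>0\<close>. Since they are
placed next to each other, starting at \<open>0\<close>, every point strictly between \<open>0\<close> and \<open>2 * pi\<close> eventually
has a neighbourhood on which the functions are constant.\<close>

lemma W_comb_tendsto:
  assumes \<gamma>: "0 < \<gamma>" and uv: "\<And>k. u k < v k" and lim: "u \<longlonglongrightarrow> z"
    and len: "(\<lambda>k. real (m k) * (v k - u k)) \<longlonglongrightarrow> 0" and m: "\<And>k. 0 < m k"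
  shows "(\<lambda>k. W (cones (u k) \<gamma> (comb (2 * (v k - u k) / \<gamma>) (m k)) (\<lambda>_. v k))) \<longlonglongrightarrow> W (\<lambda>_. z)"
proof -
  define P where "P k = 2 * (v k - u k) / \<gamma>" for k
  have P: "0 < P k" "\<gamma> * (P k / 2) = v k - u k" for k using uv[of k] \<gamma> by (auto simp: P_def)
  let ?F = "\<lambda>k. cones (u k) \<gamma> (comb (P k) (m k)) (\<lambda>_. v k)"
  have vb: "(\<lambda>_. v k) \<in> band (u k) (v k) \<gamma>" for k using \<gamma> uv[of k] by (intro const_in_band) auto
  have b: "bdd_above ((\<lambda>_. v k) ` E)" for k and E :: "real set" by (auto simp: bdd_above_def)
  show ?thesis
    unfolding P_def[symmetric]
  proof (rule W_tendsto[where L = \<gamma> and N = "{}"])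
    show "?F k \<in> periodic_Lip" for k by (rule band_cones_in_periodic_Lip[OF vb comb_periodic])
    show "\<gamma>-lipschitz_on UNIV (?F k)" for k using \<gamma> by (intro cones_lipschitz b) auto
    have lo: "u k \<le> ?F k t" for k t using \<gamma> by (intro cones_ge(1)[OF b]) auto
    have hi: "?F k t \<le> v k" for k t
      using \<gamma> uv[of k] by (subst cones_le_iff[OF b]) (auto simp: mult_nonneg_nonneg)
    have width: "v k - u k \<le> real (m k) * (v k - u k)" for k
      using mult_right_mono[of 1 "real (m k)" "v k - u k"] m[of k] uv[of k] by simp
    have vu: "(\<lambda>k. v k - u k) \<longlonglongrightarrow> 0"
      by (rule tendsto_sandwich[OF _ _ tendsto_const len])
        (use width uv in \<open>auto intro!: always_eventually less_imp_le\<close>)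
    show "uniform_limit UNIV ?F (\<lambda>_. z) sequentially"
    proof (rule uniform_limitI)
      fix e :: real assume "0 < e"
      have "\<forall>\<^sub>F k in sequentially. dist (u k) z < e / 2" "\<forall>\<^sub>F k in sequentially. dist (v k - u k) 0 < e / 2"
        using \<open>0 < e\<close> by (intro tendstoD[OF lim] tendstoD[OF vu]; simp)+
      then show "\<forall>\<^sub>F k in sequentially. \<forall>t\<in>UNIV. dist (?F k t) z < e"
      proof eventually_elim
        case (elim k)
        have "dist (?F k t) z < e" for t using elim lo[of k t] hi[of k t] unfolding dist_real_def by linarith
        then show ?case by blast
      qed
    qed
    fix t :: real assume t: "0 < t" "t < 2 * pi"
    have flat: "?F k s = u k" if s: "real (m k) * P k + P k / 2 \<le> s" "s + P k / 2 \<le> 2 * pi" for k s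
    proof -
      have mp: "0 \<le> real (m k) * P k" using P(1)[of k] by simp
      have "?F k s \<le> cones (u k) \<gamma> (lifted_arc 0 (real (m k) * P k)) (\<lambda>_. v k) s"
        using comb_subset_arc[of "P k" "m k"] P(1)[of k] \<gamma> cones_ge[OF b, of \<gamma>]
        by (subst cones_le_iff[OF b]) (auto)
      also have "\<dots> = max (u k) (v k - \<gamma> * min (s - real (m k) * P k) (2 * pi - s))"
        using s mp P(1)[of k] \<gamma> by (intro cones_arc_const) linarith+
      also have "\<dots> = u k"
      proof -
        have "P k / 2 \<le> min (s - real (m k) * P k) (2 * pi - s)" using s by simp
        then have "\<gamma> * (P k / 2) \<le> \<gamma> * min (s - real (m k) * P k) (2 * pi - s)"
          using \<gamma> by (intro mult_left_mono) auto
        then show ?thesis using P(2)[of k] by simp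
      qed
      finally show ?thesis using lo[of k s] by simp
    qed
    define w where "w = min t (2 * pi - t) / 2"
    have w: "0 < w" "2 * w \<le> t" "2 * w \<le> 2 * pi - t" using t by (auto simp: w_def)
    have "(\<lambda>k. 2 * (real (m k) * (v k - u k)) / \<gamma> + (v k - u k) / \<gamma>) \<longlonglongrightarrow> 2 * 0 / \<gamma> + 0 / \<gamma>"
      using len vu \<gamma> by (intro tendsto_intros) auto
    moreover have "real (m k) * P k + P k / 2 = 2 * (real (m k) * (v k - u k)) / \<gamma> + (v k - u k) / \<gamma>" for k
      unfolding P_def using \<gamma> by (simp add: field_simps)
    ultimately have "(\<lambda>k. real (m k) * P k + P k / 2) \<longlonglongrightarrow> 0" by simp
    then have "\<forall>\<^sub>F k in sequentially. real (m k) * P k + P k / 2 < w" using w by (intro order_tendstoD) auto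
    then show "\<forall>\<^sub>F k in sequentially. \<exists>d. \<forall>\<^sub>F s in nhds t. ?F k s = z + d"
    proof eventually_elim
      case (elim k)
      have "0 \<le> real (m k) * P k" using P(1)[of k] by simp
      then have p2: "P k / 2 < w" using elim by linarith
      have "?F k s = u k" if "\<bar>s - t\<bar> < w" for s
        using elim p2 that w by (intro flat) linarith+
      moreover have "\<forall>\<^sub>F s in nhds t. \<bar>s - t\<bar> < w"
        using eventually_nhds_ball[OF w(1), of t] by (simp add: dist_real_def abs_minus_commute)
      ultimately show ?case by (intro exI[of _ "u k - z"]) (auto elim: eventually_mono)
    qed
  qed auto
qed

text \<open>Suppose that the bound fails for all constants. Then there are intervals from \<open>u k\<close> to \<open>v k\<close>, with
\<open>u k\<close> convergent, whose contribution exceeds \<open>2^k * (v k - u k)\<close> while \<open>v k - u k \<le> (1/2)^k\<close>. Repeat the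
corresponding spike \<open>m k\<close> times, where \<open>m k * (v k - u k)\<close> has the order of magnitude \<open>(1/2)^k\<close>. These
functions converge to a constant, but the total contribution of their spikes stays at least \<open>1\<close> in absolute value.\<close>

lemma climb_local_Lipschitz:
  assumes \<gamma>: "0 < \<gamma>"
  shows "\<exists>B \<delta>. 0 < \<delta> \<and> (\<forall>u v. p \<le> u \<longrightarrow> u \<le> v \<longrightarrow> v \<le> q \<longrightarrow> v - u \<le> \<delta> \<longrightarrow> \<bar>climb \<gamma> u v\<bar> \<le> B * (v - u))"
proof (rule ccontr)
  assume "\<not> ?thesis"
  then have "\<exists>u v. p \<le> u \<and> u \<le> v \<and> v \<le> q \<and> v - u \<le> (1/2)^k \<and> 2^k * (v - u) < \<bar>climb \<gamma> u v\<bar>" for k :: nat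
    by (metis linorder_not_le zero_less_divide_1_iff zero_less_numeral zero_less_power)
  then obtain u0 v0 where 0: "\<And>k::nat. p \<le> u0 k \<and> u0 k \<le> v0 k \<and> v0 k \<le> q \<and> v0 k - u0 k \<le> (1/2)^k
      \<and> 2^k * (v0 k - u0 k) < \<bar>climb \<gamma> (u0 k) (v0 k)\<bar>"
    by metis
  have "\<forall>k. u0 k \<in> {p..q}" using 0 by (auto intro: order_trans)
  then obtain z r where r: "strict_mono r" and z: "(u0 \<circ> r) \<longlonglongrightarrow> z"
    using compact_Icc[of p q] unfolding compact_def by blast
  define u v where "u k = u0 (r k)" "v k = v0 (r k)" for k
  have rk: "k \<le> r k" for k using r by (rule seq_suble)
  have uv: "u k < v k" and small: "v k - u k \<le> (1/2)^k" and big: "2^k * (v k - u k) < \<bar>climb \<gamma> (u k) (v k)\<bar>" for k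
  proof -
    note 1 = 0[of "r k", folded u_v_def]
    show lt: "u k < v k"
    proof (rule ccontr)
      assume "\<not> u k < v k"
      then have "u k = v k" using 1 by linarith
      then show False using 1 climb_refl[of \<gamma>] \<gamma> by simp
    qed
    have "(1/2)^r k \<le> (1/2::real)^k" using rk by (intro power_decreasing) auto
    then show "v k - u k \<le> (1/2)^k" using 1 by linarith
    have "(2::real)^k * (v k - u k) \<le> 2^r k * (v k - u k)"
      using rk lt by (intro mult_right_mono power_increasing) auto
    then show "2^k * (v k - u k) < \<bar>climb \<gamma> (u k) (v k)\<bar>" using 1 by linarith
  qed
  define m where "m k = nat \<lceil>(1/2)^k / (v k - u k)\<rceil>" for k
  have m: "(1/2)^k \<le> real (m k) * (v k - u k)" "real (m k) * (v k - u k) \<le> 2 * (1/2)^k" "0 < m k" for k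
  proof -
    have "0 < (1/2)^k / (v k - u k)" using uv[of k] by simp
    then have *: "(1/2)^k / (v k - u k) \<le> real (m k)" "real (m k) \<le> (1/2)^k / (v k - u k) + 1" "0 < m k"
      unfolding m_def by linarith+
    show "(1/2)^k \<le> real (m k) * (v k - u k)" "0 < m k" using * uv[of k] by (auto simp: field_simps)
    have "real (m k) * (v k - u k) \<le> ((1/2)^k / (v k - u k) + 1) * (v k - u k)"
      using * uv[of k] by (intro mult_right_mono) auto
    also have "\<dots> = (1/2)^k + (v k - u k)" using uv[of k] by (simp add: field_simps)
    finally show "real (m k) * (v k - u k) \<le> 2 * (1/2)^k" using small[of k] by simp
  qed
  have half: "(\<lambda>k. 2 * (1/2::real)^k) \<longlonglongrightarrow> 0"
    by (intro tendsto_mult_right_zero LIMSEQ_power_zero) auto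
  have len: "(\<lambda>k. real (m k) * (v k - u k)) \<longlonglongrightarrow> 0"
    by (rule tendsto_sandwich[OF _ _ tendsto_const half])
      (use m uv in \<open>auto intro!: always_eventually less_imp_le[OF mult_pos_pos]\<close>)
  have "u = u0 \<circ> r" by (auto simp: u_v_def)
  then have u: "u \<longlonglongrightarrow> z" using z by simp
  let ?d = "\<lambda>k. W (cones (u k) \<gamma> (comb (2 * (v k - u k) / \<gamma>) (m k)) (\<lambda>_. v k)) - W (\<lambda>_. u k)"
  have d: "?d \<longlonglongrightarrow> W (\<lambda>_. z) - W (\<lambda>_. z)"
    by (intro tendsto_intros W_comb_tendsto W_const_tendsto \<gamma> uv u len m)
  have "(\<lambda>k. (?d k + real (m k) * (v k - u k) / (pi * \<gamma>) * W (\<lambda>_. u k)) / 2)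
      \<longlonglongrightarrow> (W (\<lambda>_. z) - W (\<lambda>_. z) + 0 / (pi * \<gamma>) * W (\<lambda>_. z)) / 2"
    using \<gamma> by (intro tendsto_intros d len W_const_tendsto u) auto
  then have "(\<lambda>k. (?d k + real (m k) * (v k - u k) / (pi * \<gamma>) * W (\<lambda>_. u k)) / 2) \<longlonglongrightarrow> 0" by simp
  then have ev1: "\<forall>\<^sub>F k in sequentially. \<bar>(?d k + real (m k) * (v k - u k) / (pi * \<gamma>) * W (\<lambda>_. u k)) / 2\<bar> < 1"
    by (auto dest!: tendstoD[of _ 0 sequentially 1] simp only: dist_real_def diff_0_right zero_less_one)
  have ev2: "\<forall>\<^sub>F k in sequentially. real (m k) * (v k - u k) < pi * \<gamma>"
    using len \<gamma> by (intro order_tendstoD) auto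
  have "\<forall>\<^sub>F k::nat in sequentially. False"
    using ev1 ev2
  proof eventually_elim
    case (elim k)
    have "real (m k) * (2 * (v k - u k) / \<gamma>) \<le> 2 * pi" using elim(2) \<gamma> by (simp add: field_simps)
    then have "?d k = real (m k) * (W (spike (u k) \<gamma> (v k)) - W (\<lambda>_. u k))"
      using W_comb[OF \<gamma>, of "u k" "v k" "m k"] uv[of k] by simp
    also have "\<dots> = 2 * (real (m k) * climb \<gamma> (u k) (v k)) - real (m k) * (v k - u k) / (pi * \<gamma>) * W (\<lambda>_. u k)"
      unfolding climb_def by (simp add: algebra_simps)
    finally have "\<bar>real (m k) * climb \<gamma> (u k) (v k)\<bar> < 1" using elim(1) by simp
    moreover have "1 \<le> real (m k) * \<bar>climb \<gamma> (u k) (v k)\<bar>"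
    proof -
      have "1 = 2^k * (1/2::real)^k" by (simp add: power_divide)
      also have "\<dots> \<le> 2^k * (real (m k) * (v k - u k))" using m(1) by (intro mult_left_mono) auto
      also have "\<dots> = real (m k) * (2^k * (v k - u k))" by simp
      also have "\<dots> \<le> real (m k) * \<bar>climb \<gamma> (u k) (v k)\<bar>" using big[of k] by (intro mult_left_mono) auto
      finally show ?thesis .
    qed
    ultimately show False by (simp add: abs_mult)
  qed
  then show False by simp
qed

end

section \<open>The kernel and the integral formula\<close>

context circle_valuation begin

lemma climb_cell_density:
  assumes \<gamma>: "0 < \<gamma>"
  shows "\<exists>\<kappa>\<in>borel_measurable borel. \<forall>u v. p \<le> u \<longrightarrow> u \<le> v \<longrightarrow> v \<le> p + pi * \<gamma> \<longrightarrow>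
    has_bochner_integral lborel (\<lambda>s. indicator {u..<v} s * \<kappa> s) (climb \<gamma> u v)"
proof -
  let ?q = "p + pi * \<gamma>"
  obtain B \<delta> where \<delta>: "0 < \<delta>" and B: "\<And>u v. p \<le> u \<Longrightarrow> u \<le> v \<Longrightarrow> v \<le> ?q \<Longrightarrow> v - u \<le> \<delta> \<Longrightarrow> \<bar>climb \<gamma> u v\<bar> \<le> B * (v - u)"
    using climb_local_Lipschitz[OF \<gamma>, of p ?q] by blast
  have diff: "climb \<gamma> p v - climb \<gamma> p u = climb \<gamma> u v" if "p \<le> u" "u \<le> v" "v \<le> ?q" for u v
    using climb_add[OF \<gamma>, of p u v] that by simp
  have lip: "\<bar>climb \<gamma> p y - climb \<gamma> p x\<bar> \<le> B * (y - x)" if "p \<le> x" "x \<le> y" "y \<le> ?q" for x y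
  proof (rule small_scale_Lipschitz[OF \<delta> _ that])
    show "\<bar>climb \<gamma> p y - climb \<gamma> p x\<bar> \<le> B * (y - x)"
      if "p \<le> x" "x \<le> y" "y \<le> ?q" "y - x \<le> \<delta>" for x y
      using diff[OF that(1-3)] B[OF that] by (simp only:)
  qed
  have "p \<le> ?q" using \<gamma> by simp
  then obtain \<kappa> where "\<kappa> \<in> borel_measurable borel" and
    "\<And>x y. p \<le> x \<Longrightarrow> x \<le> y \<Longrightarrow> y \<le> ?q \<Longrightarrow>
      has_bochner_integral lborel (\<lambda>s. indicator {x..<y} s * \<kappa> s) (climb \<gamma> p y - climb \<gamma> p x)"
    using Lipschitz_density[of p ?q "climb \<gamma> p" B, OF _ lip] by metis
  then show ?thesis by (intro bexI[of _ \<kappa>] allI impI) (use diff in \<open>simp_all only: refl\<close>)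
qed

text \<open>Densities on the cells of length \<open>pi * \<gamma>\<close> are glued. An interval that satisfies the
length restriction of \<open>climb_add\<close> meets at most two cells.\<close>

lemma climb_density:
  assumes \<gamma>: "0 < \<gamma>"
  shows "\<exists>\<kappa>\<in>borel_measurable borel. \<forall>u v. u \<le> v \<longrightarrow> v - u \<le> pi * \<gamma> \<longrightarrow>
    has_bochner_integral lborel (\<lambda>s. indicator {u..<v} s * \<kappa> s) (climb \<gamma> u v)"
proof -
  let ?w = "pi * \<gamma>"
  have w: "0 < ?w" using \<gamma> by simp
  have "\<forall>j::int. \<exists>\<kappa>. \<kappa> \<in> borel_measurable borel \<and> (\<forall>u v. of_int j * ?w \<le> u \<longrightarrow> u \<le> v \<longrightarrow> v \<le> of_int j * ?w + ?w \<longrightarrow>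
    has_bochner_integral lborel (\<lambda>s. indicator {u..<v} s * \<kappa> s) (climb \<gamma> u v))"
    using climb_cell_density[OF \<gamma>] by blast
  then obtain k :: "int \<Rightarrow> real \<Rightarrow> real" where k[measurable]: "\<And>j. k j \<in> borel_measurable borel" and
    kint: "\<And>j u v. of_int j * ?w \<le> u \<Longrightarrow> u \<le> v \<Longrightarrow> v \<le> of_int j * ?w + ?w \<Longrightarrow>
    has_bochner_integral lborel (\<lambda>s. indicator {u..<v} s * k j s) (climb \<gamma> u v)"
    by metis
  define \<kappa> where "\<kappa> s = k \<lfloor>s / ?w\<rfloor> s" for s
  have meas: "\<kappa> \<in> borel_measurable borel"
    unfolding \<kappa>_def by (rule measurable_compose_countable[where f = k]) measurable
  have cell: "has_bochner_integral lborel (\<lambda>s. indicator {u..<v} s * \<kappa> s) (climb \<gamma> u v)"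
    if j: "of_int j * ?w \<le> u" "u \<le> v" "v \<le> of_int j * ?w + ?w" for j :: int and u v
  proof -
    have "\<lfloor>s / ?w\<rfloor> = j" if "u \<le> s" "s < v" for s
    proof -
      have "of_int j * ?w \<le> s" "s < of_int j * ?w + ?w" using j that by linarith+
      then have "of_int j \<le> s / ?w" "s / ?w < of_int j + 1"
        using w by (simp_all add: pos_le_divide_eq pos_divide_less_eq distrib_right)
      then show ?thesis by linarith
    qed
    then have "indicator {u..<v} s * k j s = indicator {u..<v} s * \<kappa> s" for s
      by (simp add: \<kappa>_def split: split_indicator)
    then show ?thesis using kint[OF j] by (simp only:)
  qed
  have "has_bochner_integral lborel (\<lambda>s. indicator {u..<v} s * \<kappa> s) (climb \<gamma> u v)"
    if uv: "u \<le> v" "v - u \<le> ?w" for u v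
  proof -
    define j where "j = \<lfloor>u / ?w\<rfloor>"
    define z where "z = of_int j * ?w + ?w"
    have "of_int j \<le> u / ?w" "u / ?w < of_int j + 1" unfolding j_def by linarith+
    then have j: "of_int j * ?w \<le> u" "u \<le> z"
      using w by (simp_all add: z_def pos_le_divide_eq pos_divide_less_eq distrib_right)
    show ?thesis
    proof (cases "v \<le> z")
      case True
      then show ?thesis using cell[OF j(1) uv(1)] by (simp add: z_def)
    next
      case False
      have "has_bochner_integral lborel (\<lambda>s. indicator {u..<z} s * \<kappa> s) (climb \<gamma> u z)"
        using cell[OF j(1,2)] by (simp add: z_def)
      moreover have "has_bochner_integral lborel (\<lambda>s. indicator {z..<v} s * \<kappa> s) (climb \<gamma> z v)"
      proof (rule cell[of "j + 1"])
        have z: "of_int (j + 1) * ?w = z" by (simp add: z_def distrib_right)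
        show "of_int (j + 1) * ?w \<le> z" "v \<le> of_int (j + 1) * ?w + ?w" "z \<le> v"
          unfolding z using False uv j by linarith+
      qed
      ultimately have "has_bochner_integral lborel
          (\<lambda>s. indicator {u..<z} s * \<kappa> s + indicator {z..<v} s * \<kappa> s) (climb \<gamma> u z + climb \<gamma> z v)"
        by (rule has_bochner_integral_add)
      moreover have "climb \<gamma> u z + climb \<gamma> z v = climb \<gamma> u v"
        using False j uv by (intro climb_add[OF \<gamma>]) auto
      moreover have "indicator {u..<z} s * \<kappa> s + indicator {z..<v} s * \<kappa> s = indicator {u..<v} s * \<kappa> s" for s
        using False j by (auto split: split_indicator)
      ultimately show ?thesis by simp
    qed
  qed
  then show ?thesis using meas by (intro bexI[of _ \<kappa>]) auto
qed

end

lemma has_bochner_integral_interval_split: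
  fixes G :: "real \<Rightarrow> real"
  assumes "a \<le> b" "b \<le> d"
    and "has_bochner_integral lborel (\<lambda>t. indicator {a..<b} t * G t) I"
    and "has_bochner_integral lborel (\<lambda>t. indicator {b..<d} t * G t) J"
  shows "has_bochner_integral lborel (\<lambda>t. indicator {a..<d} t * G t) (I + J)"
proof -
  have "indicator {a..<d} t * G t = indicator {a..<b} t * G t + indicator {b..<d} t * G t" for t
    using assms(1,2) by (auto split: split_indicator)
  then show ?thesis using has_bochner_integral_add[OF assms(3,4)] by (simp only:)
qed

lemma deriv_affine:
  fixes f :: "real \<Rightarrow> real"
  assumes "\<And>t. a \<le> t \<Longrightarrow> t \<le> b \<Longrightarrow> f t = y + m * (t - a)" "a < t" "t < b"
  shows "deriv f t = m"
proof (rule DERIV_imp_deriv)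
  have "((\<lambda>t. y + m * (t - a)) has_real_derivative m) (at t)"
    by (auto intro!: derivative_eq_intros)
  then show "(f has_real_derivative m) (at t)"
    by (rule has_field_derivative_transform_within_open[where S = "{a<..<b}"]) (use assms in auto)
qed

context circle_valuation begin

definition climb_rate :: "real \<Rightarrow> real \<Rightarrow> real" where
  "climb_rate \<gamma> = (SOME \<kappa>. \<kappa> \<in> borel_measurable borel \<and> (\<forall>u v. u \<le> v \<longrightarrow> v - u \<le> pi * \<gamma> \<longrightarrow>
    has_bochner_integral lborel (\<lambda>s. indicator {u..<v} s * \<kappa> s) (climb \<gamma> u v)))"

lemma climb_rate:
  assumes "0 < \<gamma>"
  shows "climb_rate \<gamma> \<in> borel_measurable borel"
    and "u \<le> v \<Longrightarrow> v - u \<le> pi * \<gamma> \<Longrightarrow>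
      has_bochner_integral lborel (\<lambda>s. indicator {u..<v} s * climb_rate \<gamma> s) (climb \<gamma> u v)"
proof -
  have "\<exists>\<kappa>. \<kappa> \<in> borel_measurable borel \<and> (\<forall>u v. u \<le> v \<longrightarrow> v - u \<le> pi * \<gamma> \<longrightarrow>
    has_bochner_integral lborel (\<lambda>s. indicator {u..<v} s * \<kappa> s) (climb \<gamma> u v))"
    using climb_density[OF assms] by blast
  from someI_ex[OF this] show "climb_rate \<gamma> \<in> borel_measurable borel"
    and "u \<le> v \<Longrightarrow> v - u \<le> pi * \<gamma> \<Longrightarrow>
      has_bochner_integral lborel (\<lambda>s. indicator {u..<v} s * climb_rate \<gamma> s) (climb \<gamma> u v)"
    unfolding climb_rate_def[symmetric] by blast+
qed

text \<open>The factor \<open>2 * pi\<close> compensates for the normalization of the measure on the circle, and \<open>\<gamma>\<close> is the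
Jacobian of the substitution of the height for the angle on a piece of slope \<open>\<gamma>\<close>.\<close>

definition kernel :: "real \<Rightarrow> real \<Rightarrow> real" where
  "kernel s \<gamma> = (if \<gamma> = 0 then W (\<lambda>_. s) else 2 * pi * \<gamma> * climb_rate \<gamma> s)"

lemma kernel_measurable:
  assumes "0 \<le> \<gamma>"
  shows "(\<lambda>s. kernel s \<gamma>) \<in> borel_measurable borel"
proof (cases "\<gamma> = 0")
  case True
  have "continuous_on UNIV (\<lambda>s. W (\<lambda>_. s))"
    unfolding continuous_on_sequentially comp_def using W_const_tendsto by blast
  then show ?thesis using True by (simp add: kernel_def borel_measurable_continuous_onI)
next
  case False
  then show ?thesis using climb_rate(1)[of \<gamma>] assms unfolding kernel_def by simp
qed

text \<open>On a linear piece the height runs through the interval between the endpoint values with constant speed, so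
this is the density formula for \<open>climb\<close> after an affine substitution.\<close>

lemma integral_kernel_affine:
  assumes f: "f \<in> band c M l" and room: "2 * (M - c) \<le> l" and ab: "a \<le> b" "b \<le> a + pi"
    and aff: "\<And>t. a \<le> t \<Longrightarrow> t \<le> b \<Longrightarrow> f t = f a + m * (t - a)"
  shows "has_bochner_integral lborel (\<lambda>t. indicator {a..<b} t * kernel (f t) \<bar>deriv f t\<bar>)
    (2 * pi * ramp c l f a b + (b - a) * W (\<lambda>_. c))"
proof (cases "a = b")
  case True
  then show ?thesis using ramp_refl[OF f, of a] by (simp add: has_bochner_integral_zero)
next
  case False
  with ab have "a < b" by simp
  let ?H = "\<lambda>t. indicator {a..<b} t * kernel (f a + m * (t - a)) \<bar>m\<bar>"
  have fb: "f b = f a + m * (b - a)" using aff[of b] ab by simp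
  have "\<bar>f b - f a\<bar> \<le> l * \<bar>b - a\<bar>"
    using lipschitz_onD[OF bandD(2)[OF f], of b a] by (simp add: dist_real_def)
  then have "\<bar>m\<bar> * (b - a) \<le> l * (b - a)" using \<open>a < b\<close> by (simp add: fb abs_mult)
  \<comment> \<open>The slope of the piece is admissible because \<open>f\<close> itself is \<open>l\<close>-Lipschitz.\<close>
  then have ml: "\<bar>m\<bar> \<le> l" using \<open>a < b\<close> by simp
  have "has_bochner_integral lborel ?H (2 * pi * ramp c l f a b + (b - a) * W (\<lambda>_. c))"
  proof (cases "m = 0")
    case True
    have band: "(\<lambda>_. f a) \<in> band c M l" using bandD(3,4,6)[OF f] by (intro const_in_band) auto
    have "ramp c l f (0 + a) (b - a + a) = ramp c l (\<lambda>_. f a) 0 (b - a)"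
    proof (rule ramp_shift[OF band f])
      show "f (t + a) = f a" if "0 \<le> t" "t \<le> b - a" for t using aff[of "t + a"] that True by simp
    qed (use ab in auto)
    also have "\<dots> = (b - a) / (2 * pi) * (W (\<lambda>_. f a) - W (\<lambda>_. c))"
      using ab bandD(3,4)[OF f] by (intro ramp_const[OF _ _ room]) auto
    finally have "2 * pi * ramp c l f a b = (b - a) * (W (\<lambda>_. f a) - W (\<lambda>_. c))" by simp
    then have "2 * pi * ramp c l f a b + (b - a) * W (\<lambda>_. c) = (b - a) * W (\<lambda>_. f a)"
      by (simp add: right_diff_distrib)
    moreover have "has_bochner_integral lborel (\<lambda>t. indicator {a..<b} t * W (\<lambda>_. f a)) (measure lborel {a..<b} * W (\<lambda>_. f a))"
      by (intro has_bochner_integral_mult_left has_bochner_integral_real_indicator) (use ab in auto)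
    ultimately show ?thesis using True ab by (simp add: kernel_def)
  next
    case False
    define u v where "u = min (f a) (f b)" and "v = max (f a) (f b)"
    have uv: "u \<le> v" "v - u = \<bar>m\<bar> * (b - a)"
    proof -
      show "u \<le> v" unfolding u_def v_def by simp
      have "v - u = \<bar>f b - f a\<bar>" unfolding u_def v_def by linarith
      then show "v - u = \<bar>m\<bar> * (b - a)" using \<open>a < b\<close> by (simp add: fb abs_mult)
    qed
    have "v - u \<le> pi * \<bar>m\<bar>" using uv(2) ab mult_left_mono[of "b - a" pi "\<bar>m\<bar>"] by (simp add: mult.commute)
    then have "has_bochner_integral lborel (\<lambda>s. indicator {u..<v} s * climb_rate \<bar>m\<bar> s) (climb \<bar>m\<bar> u v)"
      using climb_rate(2)[of "\<bar>m\<bar>" u v] False uv by simp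
    then have "has_bochner_integral lborel
        (\<lambda>t. indicator {u..<v} (f a - m * a + m * t) * climb_rate \<bar>m\<bar> (f a - m * a + m * t)) (climb \<bar>m\<bar> u v /\<^sub>R \<bar>m\<bar>)"
      by (rule iffD1[OF lborel_has_bochner_integral_real_affine_iff[OF False, where t = "f a - m * a"
          and f = "\<lambda>s. indicator {u..<v} s * climb_rate \<bar>m\<bar> s"]])
    then have "has_bochner_integral lborel
        (\<lambda>t. (2 * pi * \<bar>m\<bar>) * (indicator {u..<v} (f a - m * a + m * t) * climb_rate \<bar>m\<bar> (f a - m * a + m * t)))
        ((2 * pi * \<bar>m\<bar>) * (climb \<bar>m\<bar> u v /\<^sub>R \<bar>m\<bar>))"
      by (rule has_bochner_integral_mult_right)
    moreover have "has_bochner_integral lborel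
        (\<lambda>t. (2 * pi * \<bar>m\<bar>) * (indicator {u..<v} (f a - m * a + m * t) * climb_rate \<bar>m\<bar> (f a - m * a + m * t)))
        I \<longleftrightarrow> has_bochner_integral lborel ?H I" for I
    proof (rule has_bochner_integral_discrete_difference[where X = "{a, b}"])
      fix t assume t: "t \<notin> {a, b}"
      have arg: "f a - m * a + m * t = f a + m * (t - a)" by (simp add: algebra_simps)
      have "f a + m * (t - a) \<in> {u..<v} \<longleftrightarrow> t \<in> {a..<b}"
      proof (cases "0 < m")
        case True
        have "0 \<le> m * (b - a)" using True ab by simp
        then have "u = f a" "v = f a + m * (b - a)" unfolding u_def v_def fb by auto
        then show ?thesis using True by (simp add: zero_le_mult_iff)
      next
        case m: False
        with False have m: "m < 0" by simp
        have "m * (b - a) < 0" using m \<open>a < b\<close> by (simp add: mult_neg_pos)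
        then have "u = f a + m * (b - a)" "v = f a" unfolding u_def v_def fb by auto
        then show ?thesis using m t by (auto simp: mult_less_0_iff)
      qed
      then show "(2 * pi * \<bar>m\<bar>) * (indicator {u..<v} (f a - m * a + m * t) * climb_rate \<bar>m\<bar> (f a - m * a + m * t)) = ?H t"
        unfolding arg using False by (simp add: kernel_def indicator_def)
    qed auto
    moreover have "(2 * pi * \<bar>m\<bar>) * (climb \<bar>m\<bar> u v /\<^sub>R \<bar>m\<bar>) = 2 * pi * climb \<bar>m\<bar> u v"
      using False by simp
    moreover have "ramp c l f a b + (b - a) / (2 * pi) * W (\<lambda>_. c) = climb \<bar>m\<bar> u v"
    proof (cases "0 < m")
      case True
      then have "0 \<le> m * (b - a)" using ab by simp
      then have "u = f a" "v = f b" unfolding u_def v_def fb by auto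
      have asc: "f t = f a + \<bar>m\<bar> * (t - a)" if "a \<le> t" "t \<le> b" for t
        using aff[OF that] True by simp
      show ?thesis
        using ramp_ascending[OF f room ab _ ml asc] False by (simp add: \<open>u = f a\<close> \<open>v = f b\<close>)
    next
      case m: False
      with False have m: "m < 0" by simp
      have "m * (b - a) < 0" using m \<open>a < b\<close> by (simp add: mult_neg_pos)
      then have "u = f b" "v = f a" unfolding u_def v_def fb by auto
      have desc: "f t = f a - \<bar>m\<bar> * (t - a)" if "a \<le> t" "t \<le> b" for t
        using aff[OF that] m by simp
      show ?thesis
        using ramp_descending[OF f room ab _ ml desc] False by (simp add: \<open>u = f b\<close> \<open>v = f a\<close>)
    qed
    then have "2 * pi * climb \<bar>m\<bar> u v = 2 * pi * ramp c l f a b + (b - a) * W (\<lambda>_. c)"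
    proof -
      assume "ramp c l f a b + (b - a) / (2 * pi) * W (\<lambda>_. c) = climb \<bar>m\<bar> u v"
      then have "2 * pi * climb \<bar>m\<bar> u v = 2 * pi * (ramp c l f a b + (b - a) / (2 * pi) * W (\<lambda>_. c))"
        by simp
      then show ?thesis unfolding distrib_left by simp
    qed
    ultimately show ?thesis by simp
  qed
  moreover have "has_bochner_integral lborel ?H I \<longleftrightarrow>
      has_bochner_integral lborel (\<lambda>t. indicator {a..<b} t * kernel (f t) \<bar>deriv f t\<bar>) I" for I
  proof (rule has_bochner_integral_discrete_difference[where X = "{a}"])
    fix t assume t: "t \<notin> {a}"
    have "deriv f t = m" "f t = f a + m * (t - a)" if "a \<le> t" "t < b"
      using deriv_affine[of a b f "f a" m t, OF aff] aff[of t] that t by auto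
    then show "?H t = indicator {a..<b} t * kernel (f t) \<bar>deriv f t\<bar>"
      by (auto simp: indicator_def)
  qed auto
  ultimately show ?thesis by simp
qed

text \<open>For a given \<open>f\<close>, a floor below its values and a sufficiently large slope of the cones are available.
The contributions of the pieces add up along the circle, and the share of the floor in them adds up
to the value of the floor itself.\<close>

lemma integral_kernel_piecewise_affine:
  assumes f: "f \<in> periodic_Lip"
    and t: "t 0 = 0" "t n = 2 * pi" "\<And>i. i < n \<Longrightarrow> t i < t (Suc i)"
    and aff: "\<And>i. i < n \<Longrightarrow> \<exists>a b. \<forall>s\<in>{t i..t (Suc i)}. f s = a * s + b"
  shows "has_bochner_integral lborel (\<lambda>s. indicator {0..<2 * pi} s * kernel (f s) \<bar>deriv f s\<bar>) (2 * pi * W f)"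
proof -
  obtain L where L: "L-lipschitz_on UNIV f" using f by (auto simp: periodic_Lip_def)
  have per: "f (s + 2 * pi) = f s" for s using f by (simp add: periodic_Lip_def)
  have "compact (f ` {0..2 * pi})"
    using lipschitz_on_continuous_on[OF L] by (intro compact_continuous_image) (auto intro: continuous_on_subset)
  then have "bounded (f ` {0..2 * pi})" by (rule compact_imp_bounded)
  then obtain M where "\<forall>y\<in>f ` {0..2 * pi}. norm y \<le> M" unfolding bounded_iff by blast
  then have M0: "\<bar>f s\<bar> \<le> M" if "s \<in> {0..2 * pi}" for s using that by simp
  have M: "\<bar>f s\<bar> \<le> M" for s
  proof -
    obtain k :: int where "2 * pi * of_int k \<le> s" "s \<le> 2 * pi + 2 * pi * of_int k"
      using lifted_arc_full[of 0] unfolding lifted_arc_def by auto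
    then have "\<bar>f (s - 2 * pi * of_int k)\<bar> \<le> M" by (intro M0) auto
    then show ?thesis using periodic_int[of f "s - 2 * pi * of_int k" k, OF per] by simp
  qed
  define l where "l = max L (2 * (M - (- M)))"
  have room: "2 * (M - (- M)) \<le> l" by (simp add: l_def)
  have band: "f \<in> band (- M) M l"
    using per lipschitz_on_mono[OF L, of UNIV l] M unfolding band_def
    by (auto simp: l_def abs_le_iff minus_le_iff)
  define c where "c = - M"
  note band = band[folded c_def] and room = room[folded c_def]
  \<comment> \<open>Contributions of arcs longer than \<open>2 * pi - 1\<close> are out of reach of \<open>ramp_add\<close>; \<open>R\<close> accumulates them in two halves.\<close>
  define R where "R x = (if x \<le> pi then ramp c l f 0 x else ramp c l f 0 pi + ramp c l f pi x)" for x
  have add: "ramp c l f x y + ramp c l f y z = ramp c l f x z" if "x \<le> y" "y \<le> z" "z - x \<le> pi" for x y z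
    using that pi_gt3 by (intro ramp_add[OF band room]) auto
  have R: "R y - R x = ramp c l f x y" if xy: "0 \<le> x" "x \<le> y" "y \<le> 2 * pi" "y - x \<le> pi" for x y
  proof -
    consider "y \<le> pi" | "x \<le> pi" "pi < y" | "pi < x" using xy by linarith
    then show ?thesis
      using add[of 0 x y] add[of 0 x pi] add[of x pi y] add[of pi x y] xy
      by cases (auto simp: R_def)
  qed
  let ?G = "\<lambda>s. kernel (f s) \<bar>deriv f s\<bar>"
  have piece: "has_bochner_integral lborel (\<lambda>s. indicator {a..<b} s * ?G s) (2 * pi * (R b - R a) + (b - a) * W (\<lambda>_. c))"
    if ab: "0 \<le> a" "a \<le> b" "b \<le> 2 * pi" "b - a \<le> pi" and af: "\<And>s. s \<in> {a..b} \<Longrightarrow> f s = p * s + q" for a b p q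
  proof -
    have af': "f s = f a + p * (s - a)" if "a \<le> s" "s \<le> b" for s
      using af[of s] af[of a] that ab by (simp add: algebra_simps)
    show ?thesis
      using integral_kernel_affine[OF band room ab(2) _ af'] ab(4) unfolding R[OF ab] by simp
  qed
  have "t i \<le> 2 * pi \<and> 0 \<le> t i \<and>
      has_bochner_integral lborel (\<lambda>s. indicator {0..<t i} s * ?G s) (2 * pi * R (t i) + t i * W (\<lambda>_. c))"
    if "i \<le> n" for i
    using that
  proof (induction i)
    case 0
    then show ?case using t(1) ramp_refl[OF band, of 0] by (simp add: R_def has_bochner_integral_zero)
  next
    case (Suc i)
    then have IH: "0 \<le> t i" "has_bochner_integral lborel (\<lambda>s. indicator {0..<t i} s * ?G s) (2 * pi * R (t i) + t i * W (\<lambda>_. c))"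
      by auto
    have lt: "t i < t (Suc i)" using t(3) Suc.prems by simp
    have "t (Suc i) \<le> t n"
      using Suc.prems
    proof (induction rule: dec_induct)
      case (step k)
      then show ?case using t(3)[of k] by simp
    qed simp
    then have le: "t (Suc i) \<le> 2 * pi" using t by simp
    obtain p q where pq: "\<And>s. s \<in> {t i..t (Suc i)} \<Longrightarrow> f s = p * s + q" using aff[of i] Suc.prems by auto
    \<comment> \<open>A piece may be longer than \<open>pi\<close>, so it is halved.\<close>
    define z where "z = (t i + t (Suc i)) / 2"
    have z: "t i \<le> z" "z \<le> t (Suc i)" "z - t i \<le> pi" "t (Suc i) - z \<le> pi"
      using lt le IH(1) by (auto simp: z_def field_simps)
    have p1: "has_bochner_integral lborel (\<lambda>s. indicator {t i..<z} s * ?G s) (2 * pi * (R z - R (t i)) + (z - t i) * W (\<lambda>_. c))"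
      using z le IH(1) pq by (intro piece[of _ _ p q]) auto
    have p2: "has_bochner_integral lborel (\<lambda>s. indicator {z..<t (Suc i)} s * ?G s)
        (2 * pi * (R (t (Suc i)) - R z) + (t (Suc i) - z) * W (\<lambda>_. c))"
      using z le IH(1) pq by (intro piece[of _ _ p q]) auto
    have "has_bochner_integral lborel (\<lambda>s. indicator {0..<t (Suc i)} s * ?G s)
        (2 * pi * R (t i) + t i * W (\<lambda>_. c) + (2 * pi * (R z - R (t i)) + (z - t i) * W (\<lambda>_. c)
          + (2 * pi * (R (t (Suc i)) - R z) + (t (Suc i) - z) * W (\<lambda>_. c))))"
      using has_bochner_integral_interval_split[OF IH(1) _ IH(2)
          has_bochner_integral_interval_split[OF z(1,2) p1 p2]] lt by simp
    then show ?case using le lt IH(1) by (simp add: algebra_simps)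
  qed
  from this[of n] have "has_bochner_integral lborel (\<lambda>s. indicator {0..<2 * pi} s * ?G s) (2 * pi * R (2 * pi) + 2 * pi * W (\<lambda>_. c))"
    using t by simp
  moreover have "2 * pi * R (2 * pi) + 2 * pi * W (\<lambda>_. c) = 2 * pi * W f"
  proof -
    have "R (2 * pi) = W f - W (\<lambda>_. c)" using ramp_close[OF band room, of 0] by (simp add: R_def)
    then show ?thesis by (simp add: right_diff_distrib)
  qed
  ultimately show ?thesis by simp
qed

end

section \<open>From the line to the circle\<close>

definition wrap :: "(real \<Rightarrow> real) \<Rightarrow> complex \<Rightarrow> real" where
  "wrap \<psi> = restrict (\<lambda>x. \<psi> (Arg2pi x)) S1"

lemma cis_Arg2pi: "x \<in> S1 \<Longrightarrow> cis (Arg2pi x) = x"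
  using complex_norm_eq_1_exp[of x] by (simp add: cis_conv_exp)

lemma Arg2pi_cis: "0 \<le> t \<Longrightarrow> t < 2 * pi \<Longrightarrow> Arg2pi (cis t) = t"
  by (rule Arg2pi_unique[where r = 1]) (simp_all add: cis_conv_exp)

lemma Arg2pi_cis_ex: "\<exists>k::int. t = Arg2pi (cis t) + 2 * pi * of_int k"
proof -
  obtain k :: int where k: "2 * pi * of_int k \<le> t" "t \<le> 2 * pi + 2 * pi * of_int k"
    using lifted_arc_full[of 0] unfolding lifted_arc_def by auto
  have per: "cis (t - 2 * pi * of_int j) = cis t" for j :: int
    using periodic_int[of cis "t - 2 * pi * of_int j" j, OF cis_add_2pi] by simp
  show ?thesis
  proof (cases "t = 2 * pi + 2 * pi * of_int k")
    case True
    then have "Arg2pi (cis t) = 0" using per[of "k + 1"] Arg2pi_cis[of 0] by (simp add: algebra_simps)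
    then show ?thesis using True by (intro exI[of _ "k + 1"]) (simp add: algebra_simps)
  next
    case False
    then have "Arg2pi (cis t) = t - 2 * pi * of_int k"
      using Arg2pi_cis[of "t - 2 * pi * of_int k"] k by (simp add: per)
    then show ?thesis by (intro exI[of _ k]) simp
  qed
qed

lemma wrap_cis:
  assumes "\<And>t. \<psi> (t + 2 * pi) = \<psi> t"
  shows "wrap \<psi> (cis t) = \<psi> t"
proof -
  obtain k :: int where "t = Arg2pi (cis t) + 2 * pi * of_int k" using Arg2pi_cis_ex by blast
  then have "\<psi> t = \<psi> (Arg2pi (cis t))" using periodic_int[of \<psi> "Arg2pi (cis t)" k, OF assms] by simp
  then show ?thesis by (simp add: wrap_def)
qed

lemma periodic_LipD: "\<psi> \<in> periodic_Lip \<Longrightarrow> \<psi> (t + 2 * pi) = \<psi> t"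
  by (simp add: periodic_Lip_def)

lemma wrap_in_Lip:
  assumes \<psi>: "\<psi> \<in> periodic_Lip"
  shows "wrap \<psi> \<in> Lip_S1"
proof -
  obtain L where L: "L-lipschitz_on UNIV \<psi>" using \<psi> by (auto simp: periodic_Lip_def)
  have L0: "0 \<le> L" using L by (simp add: lipschitz_on_def)
  have "(2 * L)-lipschitz_on S1 (wrap \<psi>)"
  proof (rule lipschitz_onI)
    fix x y :: complex assume xy: "x \<in> S1" "y \<in> S1"
    define a where "a = Arg2pi x"
    have a: "0 \<le> a" "a < 2 * pi" "cis a = x" using Arg2pi[of x] cis_Arg2pi[OF xy(1)] by (auto simp: a_def)
    have b: "0 \<le> Arg2pi y" "Arg2pi y < 2 * pi" "cis (Arg2pi y) = y" using Arg2pi[of y] cis_Arg2pi[OF xy(2)] by auto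
    define b where "b = (if \<bar>a - Arg2pi y\<bar> \<le> pi then Arg2pi y else if a < Arg2pi y then Arg2pi y - 2 * pi else Arg2pi y + 2 * pi)"
    have ab: "\<bar>a - b\<bar> \<le> pi" using a b unfolding b_def by (auto simp: abs_le_iff)
    have "cis b = y" using b(3) cis_add_2pi[of "Arg2pi y"] cis_add_2pi[of "Arg2pi y - 2 * pi"] by (auto simp: b_def)
    have "dist (wrap \<psi> x) (wrap \<psi> y) = dist (\<psi> a) (\<psi> b)"
      using wrap_cis[of \<psi>, OF periodic_LipD[OF \<psi>]] a(3) \<open>cis b = y\<close> by metis
    also have "\<dots> \<le> L * \<bar>a - b\<bar>" using lipschitz_onD[OF L, of a b] by (simp add: dist_real_def)
    also have "\<dots> \<le> L * (2 * dist x y)"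
      using dist_cis_ge_half[OF ab] a(3) \<open>cis b = y\<close> L0 by (intro mult_left_mono) auto
    finally show "dist (wrap \<psi> x) (wrap \<psi> y) \<le> 2 * L * dist x y" by simp
  qed (use L0 in simp)
  then show ?thesis unfolding Lip_S1_def wrap_def by auto
qed

lemma unwrap:
  assumes f: "f \<in> Lip_S1"
  shows "(\<lambda>t. f (cis t)) \<in> periodic_Lip" "wrap (\<lambda>t. f (cis t)) = f"
proof -
  obtain L where L: "L-lipschitz_on S1 f" using f by (auto simp: Lip_S1_def)
  have L0: "0 \<le> L" using L by (simp add: lipschitz_on_def)
  have "L-lipschitz_on UNIV (\<lambda>t. f (cis t))"
  proof (rule lipschitz_onI)
    fix s t
    have "dist (f (cis s)) (f (cis t)) \<le> L * dist (cis s) (cis t)" by (rule lipschitz_onD[OF L]) auto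
    also have "\<dots> \<le> L * dist s t" using dist_cis_le[of s t] L0 by (intro mult_left_mono) (auto simp: dist_real_def)
    finally show "dist (f (cis s)) (f (cis t)) \<le> L * dist s t" .
  qed (rule L0)
  then show "(\<lambda>t. f (cis t)) \<in> periodic_Lip" by (auto simp: periodic_Lip_def cis_add_2pi)
  have "f \<in> extensional S1" using f by (simp add: Lip_S1_def)
  then show "wrap (\<lambda>t. f (cis t)) = f"
    unfolding wrap_def using cis_Arg2pi by (intro extensionalityI[of _ S1]) auto
qed

lemma circle_deriv_wrap:
  assumes "\<psi> \<in> periodic_Lip" shows "circle_deriv (wrap \<psi>) x = deriv \<psi> (Arg2pi x)"
proof -
  have "(\<lambda>t. wrap \<psi> (cis t)) = \<psi>" using wrap_cis[of \<psi>, OF periodic_LipD[OF assms]] by blast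
  then show ?thesis by (simp add: circle_deriv_def)
qed

text \<open>A bound on the derivative at all points, including those where \<open>\<psi>\<close> is not differentiable: there
\<^const>\<open>deriv\<close> takes one fixed value, the arbitrary number \<open>SOME D. False\<close>.\<close>

lemma abs_deriv_le:
  assumes L: "L-lipschitz_on UNIV \<psi>"
  shows "\<bar>deriv \<psi> t\<bar> \<le> max L \<bar>SOME D::real. False\<bar>"
proof (cases "\<exists>D. (\<psi> has_real_derivative D) (at t)")
  case True
  then obtain D where D: "(\<psi> has_real_derivative D) (at t)" by blast
  have "((\<lambda>y. \<bar>(\<psi> y - \<psi> t) / (y - t)\<bar>) \<longlongrightarrow> \<bar>D\<bar>) (at t)"
    using D by (intro tendsto_rabs) (simp add: has_field_derivative_iff)
  moreover have "\<forall>\<^sub>F y in at t. \<bar>(\<psi> y - \<psi> t) / (y - t)\<bar> \<le> L"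
    using eventually_neq_at_within[of t]
  proof eventually_elim
    case (elim y)
    have "\<bar>\<psi> y - \<psi> t\<bar> \<le> L * \<bar>y - t\<bar>" using lipschitz_onD[OF L, of y t] by (simp add: dist_real_def)
    then show ?case using elim by (simp add: abs_divide pos_divide_le_eq)
  qed
  ultimately have "\<bar>D\<bar> \<le> L" by (rule tendsto_upperbound) simp
  then show ?thesis using DERIV_imp_deriv[OF D] by simp
next
  case False
  then have "deriv \<psi> t = (SOME D. False)" unfolding deriv_def by simp
  then show ?thesis by simp
qed

lemma deriv_eq_of_eventually_shift:
  fixes F f :: "real \<Rightarrow> real"
  assumes "\<forall>\<^sub>F s in nhds t. F s = f s + d"
  shows "deriv F t = deriv f t"
proof -
  have "deriv F t = deriv (\<lambda>s. f s + d) t" by (rule deriv_cong_ev[OF assms refl])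
  also have "\<dots> = deriv f t"
  proof -
    have "((\<lambda>s. f s + d) has_real_derivative D) (at t) \<longleftrightarrow> (f has_real_derivative D) (at t)" for D
      using DERIV_add[of "\<lambda>s. f s + d" D t UNIV "\<lambda>_. - d" 0] DERIV_add[of f D t UNIV "\<lambda>_. d" 0] by auto
    then show ?thesis unfolding deriv_def by simp
  qed
  finally show ?thesis .
qed

lemma space_H1 [simp]: "space H1 = S1"
  by (simp add: H1_eq space_restrict_space)

lemma sets_H1: "sets H1 = sets (restrict_space borel S1)"
  by (simp add: H1_eq)

lemma cis_measurable_uniform:
  "cis \<in> measurable (uniform_measure lborel {0..<2 * pi}) (restrict_space borel S1)"
  using cis_measurable_S1 by (simp cong: measurable_cong_sets)

lemma finite_null_H1:
  assumes "finite N"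
  shows "AE x in H1. Arg2pi x \<notin> N"
proof -
  let ?A = "{x \<in> S1. Arg2pi x \<in> N}"
  have "?A \<subseteq> cis ` N" using cis_Arg2pi by force
  then have fin: "finite ?A" using assms finite_surj by blast
  then have meas: "?A \<in> sets (restrict_space borel S1)"
    by (auto simp: sets_restrict_space_iff intro: borel_closed finite_imp_closed)
  have "emeasure H1 ?A = emeasure (uniform_measure lborel {0..<2 * pi}) (cis -` ?A)"
    unfolding H1_eq using meas by (subst emeasure_distr[OF cis_measurable_uniform]) auto
  also have "\<dots> = emeasure lborel ({0..<2 * pi} \<inter> cis -` ?A) / emeasure lborel {0..<2 * pi}"
  proof (rule emeasure_uniform_measure)
    show "cis -` ?A \<in> sets lborel"
      using measurable_sets[OF cis_measurable, of ?A] fin by (auto intro: borel_closed finite_imp_closed)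
  qed simp
  also have "{0..<2 * pi} \<inter> cis -` ?A \<subseteq> N" using Arg2pi_cis by auto
  then have "emeasure lborel ({0..<2 * pi} \<inter> cis -` ?A) = 0"
    using assms finite_subset by (intro emeasure_lborel_countable countable_finite) blast
  finally have "emeasure H1 ?A = 0" by simp
  then have "?A \<in> null_sets H1" using meas by (auto simp: null_sets_def sets_H1)
  then show ?thesis by (rule AE_I') auto
qed

lemma Arg2pi_measurable: "Arg2pi \<in> borel_measurable borel"
  unfolding borel_measurable_iff_le using closed_Arg2pi2pi_le by (auto intro: borel_closed)

lemma has_bochner_integral_H1:
  fixes G :: "real \<Rightarrow> real"
  assumes G: "has_bochner_integral lborel (\<lambda>t. indicator {0..<2 * pi} t * G t) (2 * pi * I)"
  shows "has_bochner_integral H1 (\<lambda>x. G (Arg2pi x)) I"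
proof -
  define H where "H t = indicator {0..<2 * pi} t * G t" for t
  have H: "H \<in> borel_measurable borel"
    using G unfolding has_bochner_integral_iff H_def[symmetric] by (auto dest: borel_measurable_integrable)
  have HA: "(\<lambda>x. H (Arg2pi x)) \<in> borel_measurable borel"
    by (rule measurable_compose[OF Arg2pi_measurable H])
  have HC: "(\<lambda>t. H (Arg2pi (cis t))) \<in> borel_measurable borel"
    by (rule measurable_compose[OF cis_measurable HA])
  have unif: "uniform_measure lborel {0..<2 * pi} = density lborel (\<lambda>t. ennreal (indicator {0..<2 * pi} t / (2 * pi)))"
    unfolding uniform_measure_def
  proof (intro density_cong)
    show "AE t in lborel. indicator {0..<2 * pi} t / emeasure lborel {0..<2 * pi}
        = ennreal (indicator {0..<2 * pi} t / (2 * pi))"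
    proof (rule always_eventually, rule allI)
      fix t :: real
      have "emeasure lborel {0..<2 * pi} = ennreal (2 * pi)" by simp
      moreover have "1 / ennreal (2 * pi) = ennreal (1 / (2 * pi))"
        using divide_ennreal[of 1 "2 * pi"] by simp
      ultimately show "indicator {0..<2 * pi} t / emeasure lborel {0..<2 * pi}
          = ennreal (indicator {0..<2 * pi} t / (2 * pi))"
        by (cases "t \<in> {0..<2 * pi}") (simp_all only: indicator_simps, simp)
    qed
  qed auto
  have hb: "has_bochner_integral lborel (\<lambda>t. (indicator {0..<2 * pi} t / (2 * pi)) *\<^sub>R H (Arg2pi (cis t))) I"
  proof -
    have "has_bochner_integral lborel (\<lambda>t. 1 / (2 * pi) * H t) (1 / (2 * pi) * (2 * pi * I))"
      using G unfolding H_def by (rule has_bochner_integral_mult_right)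
    moreover have "1 / (2 * pi) * H t = (indicator {0..<2 * pi} t / (2 * pi)) *\<^sub>R H (Arg2pi (cis t))" for t
    proof (cases "t \<in> {0..<2 * pi}")
      case True
      then have "Arg2pi (cis t) = t" by (intro Arg2pi_cis) auto
      then show ?thesis using True by simp
    qed (simp add: H_def)
    moreover have "1 / (2 * pi) * (2 * pi * I) = I" by simp
    ultimately show ?thesis by (simp only:)
  qed
  have unif_int: "has_bochner_integral (uniform_measure lborel {0..<2 * pi}) (\<lambda>t. H (Arg2pi (cis t))) I"
    unfolding unif
  proof (rule has_bochner_integral_density[OF _ _ _ hb])
    show "(\<lambda>t. H (Arg2pi (cis t))) \<in> borel_measurable lborel" using HC by simp
    show "(\<lambda>t. indicator {0..<2 * pi} t / (2 * pi)) \<in> borel_measurable lborel" by measurable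
    show "AE t in lborel. (0 :: real) \<le> indicator {0..<2 * pi} t / (2 * pi)" by (intro always_eventually) auto
  qed
  have "has_bochner_integral H1 (\<lambda>x. H (Arg2pi x)) I"
    unfolding H1_eq
  proof (rule has_bochner_integral_distr[OF _ cis_measurable_uniform unif_int])
    show "(\<lambda>x. H (Arg2pi x)) \<in> borel_measurable (restrict_space borel S1)"
      by (rule measurable_restrict_space1[OF HA])
  qed
  moreover have "H (Arg2pi x) = G (Arg2pi x)" for x
    using Arg2pi[of x] by (simp add: H_def)
  ultimately show ?thesis by simp
qed

text \<open>Rotations and the complex conjugation act on the line as translations and as the reflection. For the
continuity assumption, derivatives of functions that differ locally by a constant are equal.\<close>

lemma circle_valuation_wrap:
  assumes val: "valuation_on_Lip V" and tau: "tau_continuous V" and rot: "rotation_invariant V"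
  shows "circle_valuation (\<lambda>\<psi>. V (wrap \<psi>))"
proof
  fix f g :: "real \<Rightarrow> real" assume f: "f \<in> periodic_Lip" and g: "g \<in> periodic_Lip"
  have "wrap (\<lambda>t. max (f t) (g t)) = (\<lambda>x. max (wrap f x) (wrap g x))"
    "wrap (\<lambda>t. min (f t) (g t)) = (\<lambda>x. min (wrap f x) (wrap g x))"
    by (auto simp: wrap_def restrict_def)
  then show "V (wrap (\<lambda>t. max (f t) (g t))) + V (wrap (\<lambda>t. min (f t) (g t))) = V (wrap f) + V (wrap g)"
    using val wrap_in_Lip[OF f] wrap_in_Lip[OF g] by (simp add: valuation_on_Lip_def)
next
  fix f :: "real \<Rightarrow> real" and s assume f: "f \<in> periodic_Lip"
  have "orthogonal_transformation ((*) (cis s))"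
    by (auto simp: orthogonal_transformation norm_mult intro!: linearI algebra_simps)
  then have "V (wrap f \<circ> (*) (cis s)) = V (wrap f)"
    using rot wrap_in_Lip[OF f] unfolding rotation_invariant_def by blast
  moreover have "wrap (\<lambda>t. f (t + s)) = wrap f \<circ> (*) (cis s)"
  proof
    fix x
    show "wrap (\<lambda>t. f (t + s)) x = (wrap f \<circ> (*) (cis s)) x"
    proof (cases "x \<in> S1")
      case True
      then have "cis s * x = cis (Arg2pi x + s)" by (simp add: cis_mult[symmetric] cis_Arg2pi mult.commute)
      then show ?thesis
        using True wrap_cis[of f "Arg2pi x + s", OF periodic_LipD[OF f]] by (simp add: wrap_def)
    next
      case False
      then show ?thesis by (simp add: wrap_def norm_mult)
    qed
  qed
  ultimately show "V (wrap (\<lambda>t. f (t + s))) = V (wrap f)" by simp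
next
  fix f :: "real \<Rightarrow> real" assume f: "f \<in> periodic_Lip"
  have "orthogonal_transformation cnj"
    by (auto simp: orthogonal_transformation intro!: linearI)
  then have "V (wrap f \<circ> cnj) = V (wrap f)"
    using rot wrap_in_Lip[OF f] unfolding rotation_invariant_def by blast
  moreover have "wrap (\<lambda>t. f (- t)) = wrap f \<circ> cnj"
  proof
    fix x
    show "wrap (\<lambda>t. f (- t)) x = (wrap f \<circ> cnj) x"
    proof (cases "x \<in> S1")
      case True
      then have "cnj x = cis (- Arg2pi x)" by (metis cis_Arg2pi cis_cnj)
      then show ?thesis
        using True wrap_cis[of f "- Arg2pi x", OF periodic_LipD[OF f]] by (simp add: wrap_def)
    next
      case False
      then show ?thesis by (simp add: wrap_def)
    qed
  qed
  ultimately show "V (wrap (\<lambda>t. f (- t))) = V (wrap f)" by simp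
next
  fix F :: "nat \<Rightarrow> real \<Rightarrow> real" and f L N
  assume F: "\<And>k. F k \<in> periodic_Lip" and f: "f \<in> periodic_Lip" and L: "\<And>k. L-lipschitz_on UNIV (F k)"
    and u: "uniform_limit UNIV F f sequentially" and N: "finite N"
    and loc: "\<And>t. 0 < t \<Longrightarrow> t < 2 * pi \<Longrightarrow> t \<notin> N \<Longrightarrow>
        \<forall>\<^sub>F k in sequentially. \<exists>d. \<forall>\<^sub>F s in nhds t. F k s = f s + d"
  have "tau_converges (\<lambda>k. wrap (F k)) (wrap f)"
    unfolding tau_converges_def
  proof (intro conjI)
    show "uniform_limit S1 (\<lambda>k. wrap (F k)) (wrap f) sequentially"
    proof (rule uniform_limitI)
      fix e :: real assume "0 < e"
      then have "\<forall>\<^sub>F n in sequentially. \<forall>t\<in>UNIV. dist (F n t) (f t) < e" by (rule uniform_limitD[OF u])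
      then show "\<forall>\<^sub>F n in sequentially. \<forall>x\<in>S1. dist (wrap (F n) x) (wrap f x) < e"
        by eventually_elim (simp add: wrap_def)
    qed
    define C where "C = max L \<bar>SOME D::real. False\<bar> + 1"
    have "0 < C" by (simp add: C_def add_nonneg_pos le_max_iff_disj)
    moreover have "\<bar>circle_deriv (wrap (F k)) x\<bar> \<le> C" for k x
      using abs_deriv_le[OF L, of k "Arg2pi x"] by (simp add: circle_deriv_wrap[OF F] C_def)
    ultimately show "\<exists>C>0. AE x in H1. \<forall>k. \<bar>circle_deriv (wrap (F k)) x\<bar> \<le> C" by auto
    have "AE x in H1. Arg2pi x \<notin> insert 0 N" using N by (intro finite_null_H1) simp
    then show "AE x in H1. (\<lambda>k. circle_deriv (wrap (F k)) x) \<longlonglongrightarrow> circle_deriv (wrap f) x"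
    proof eventually_elim
      case (elim x)
      then have "0 < Arg2pi x" "Arg2pi x < 2 * pi" "Arg2pi x \<notin> N" using Arg2pi[of x] by auto
      then have "\<forall>\<^sub>F k in sequentially. \<exists>d. \<forall>\<^sub>F s in nhds (Arg2pi x). F k s = f s + d" by (rule loc)
      then have "\<forall>\<^sub>F k in sequentially. circle_deriv (wrap (F k)) x = circle_deriv (wrap f) x"
        by eventually_elim (auto simp: circle_deriv_wrap[OF F] circle_deriv_wrap[OF f] dest: deriv_eq_of_eventually_shift)
      then show ?case by (rule tendsto_eventually)
    qed
  qed
  moreover have "\<forall>k. wrap (F k) \<in> Lip_S1" using wrap_in_Lip[OF F] by blast
  ultimately show "(\<lambda>k. V (wrap (F k))) \<longlonglongrightarrow> V (wrap f)"
    using tau[unfolded tau_continuous_def, THEN spec, THEN bspec, OF wrap_in_Lip[OF f], of "\<lambda>k. wrap (F k)"]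
    by blast
qed

theorem theorem1p2:
  fixes V :: "(complex \<Rightarrow> real) \<Rightarrow> real"
  assumes "valuation_on_Lip V"
    and "tau_continuous V"
    and "rotation_invariant V"
  shows "\<exists>K :: real \<Rightarrow> real \<Rightarrow> real.
    (\<forall>\<gamma>\<ge>0. (\<lambda>s. K s \<gamma>) \<in> borel_measurable borel) \<and>
    (\<forall>f\<in>PL_S1.
       integrable H1 (\<lambda>x. K (f x) \<bar>circle_deriv f x\<bar>) \<and>
       V f = (\<integral>x. K (f x) \<bar>circle_deriv f x\<bar> \<partial>H1)) \<and>
    (\<forall>f\<in>Lip_S1. \<forall>F :: nat \<Rightarrow> complex \<Rightarrow> real.
       (\<forall>i. F i \<in> PL_S1) \<and> tau_converges F f \<longrightarrow>
       (\<lambda>i. \<integral>x. K (F i x) \<bar>circle_deriv (F i) x\<bar> \<partial>H1) \<longlonglongrightarrow> V f)"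
proof -
  interpret circle_valuation "\<lambda>\<psi>. V (wrap \<psi>)" using assms by (rule circle_valuation_wrap)
  have int: "has_bochner_integral H1 (\<lambda>x. kernel (f x) \<bar>circle_deriv f x\<bar>) (V f)" if f: "f \<in> PL_S1" for f
  proof -
    have fL: "f \<in> Lip_S1" using f by (simp add: PL_S1_def)
    obtain n :: nat and t :: "nat \<Rightarrow> real" where t: "t 0 = 0" "t n = 2 * pi"
      and pieces: "\<And>i. i < n \<Longrightarrow> t i < t (Suc i) \<and> (\<exists>a b. \<forall>s\<in>{t i..t (Suc i)}. f (cis s) = a * s + b)"
      using f unfolding PL_S1_def by blast
    have "has_bochner_integral lborel
        (\<lambda>s. indicator {0..<2 * pi} s * kernel (f (cis s)) \<bar>deriv (\<lambda>t. f (cis t)) s\<bar>) (2 * pi * V (wrap (\<lambda>t. f (cis t))))"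
      using pieces by (intro integral_kernel_piecewise_affine[OF unwrap(1)[OF fL] t]) auto
    then have "has_bochner_integral H1
        (\<lambda>x. kernel (f (cis (Arg2pi x))) \<bar>deriv (\<lambda>t. f (cis t)) (Arg2pi x)\<bar>) (V f)"
      unfolding unwrap(2)[OF fL] by (rule has_bochner_integral_H1)
    moreover have "has_bochner_integral H1
        (\<lambda>x. kernel (f (cis (Arg2pi x))) \<bar>deriv (\<lambda>t. f (cis t)) (Arg2pi x)\<bar>) (V f)
      \<longleftrightarrow> has_bochner_integral H1 (\<lambda>x. kernel (f x) \<bar>circle_deriv f x\<bar>) (V f)"
      by (rule has_bochner_integral_cong) (auto simp: cis_Arg2pi circle_deriv_def)
    ultimately show ?thesis by simp
  qed
  show ?thesis
  proof (intro exI[of _ kernel] conjI allI ballI impI)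
    show "(\<lambda>s. kernel s \<gamma>) \<in> borel_measurable borel" if "0 \<le> \<gamma>" for \<gamma>
      using that by (rule kernel_measurable)
    show "integrable H1 (\<lambda>x. kernel (f x) \<bar>circle_deriv f x\<bar>)"
      "V f = (\<integral>x. kernel (f x) \<bar>circle_deriv f x\<bar> \<partial>H1)" if "f \<in> PL_S1" for f
      using int[OF that] by (auto simp: has_bochner_integral_iff)
    show "(\<lambda>i. \<integral>x. kernel (F i x) \<bar>circle_deriv (F i) x\<bar> \<partial>H1) \<longlonglongrightarrow> V f"
      if f: "f \<in> Lip_S1" and F: "(\<forall>i. F i \<in> PL_S1) \<and> tau_converges F f" for f F
    proof -
      have "F i \<in> Lip_S1" for i using F by (simp add: PL_S1_def)
      then have "(\<lambda>i. V (F i)) \<longlonglongrightarrow> V f" using assms(2) f F unfolding tau_continuous_def by blast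
      moreover have "V (F i) = (\<integral>x. kernel (F i x) \<bar>circle_deriv (F i) x\<bar> \<partial>H1)" for i
        using int[of "F i"] F by (simp add: has_bochner_integral_iff)
      ultimately show ?thesis by simp
    qed
  qed
qed

end
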